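(* Let $v$ be a Morse flow on a compact manifold $M$ and let $v_1$ be its time-one map. Then the abstract weak orbit space $M/[v]$ of $v$ is homeomorphic to the abstract weak orbit space $M/[v_1]$ of $v_1$.
   Context: A flow on a space $X$ is a continuous $\mathbb{R}$-action $u$; $O(x)$ is the orbit; $\omega(x)=\bigcap_{n\in\mathbb{R}}\overline{\{u_t(x): t>n\}}$, $\alpha(x)=\bigcap_{n\in\mathbb{R}}\overline{\{u_t(x): t<n\}}$, $\alpha'(x)=\alpha(x)\setminus O(x)$, $\omega'(x)=\omega(x)\setminus O(x)$. $\mathrm{Sing}(u)$, $\mathrm{Per}(u)$ are the sets of singular (fixed) and periodic (non-fixed, with positive period) points, $\mathrm{Cl}(u)$ their union; closed orbits are the singular and periodic orbits. $x$ is recurrent if $x\in\alpha(x)\cup\omega(x)$; $\mathrm{R}(u)$ is the set of recurrent points not in $\mathrm{Cl}(u)$; $\mathrm{P}(u)$ is the set of non-recurrent points. Abstract weak orbits: $[x]'$ is the connected component containing $x$ of $\{y:\alpha'(y)=\alpha'(x),\omega'(y)=\omega'(x)\}$; $[x]''$ is the connected component containing $x$ of $[x]'\cap Z$, where $Z$ is the one of $\mathrm{Sing}(u),\mathrm{Per}(u),\mathrm{P}(u),\mathrm{R}(u)$ containing $x$. $[x]_u=[x]''$ if $x\notin\mathrm{R}(u)$, and $[x]_u=\{y:\overline{O(y)}=\overline{O(x)},\alpha(y)=\alpha(x),\omega(y)=\omega(x)\}$ if $x\in\mathrm{R}(u)$. $X/[u]$ is the quotient space of $X$ by the partition $\{[x]_u\}$.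 For a homeomorphism $f:X\to X$, the mapping torus is $X_f=(X\times\mathbb{R})/\!\sim$ with $(x,t)\sim(f^n(x),t-n)$, $n\in\mathbb{Z}$, and the suspension flow is $v_f(t,[(x,s)])=[(x,t+s)]$. $[x]_f=\{y\in X:[(y,0)]\in[\,[(x,0)]\,]_{v_f}\}$, and $X/[f]$ is the quotient space of $X$ by the partition $\{[x]_f\}$; it is homeomorphic to $X_f/[v_f]$. Morse-Smale flow on a compact manifold $M$: a flow topologically equivalent (via a homeomorphism mapping orbits to orbits and preserving direction) to the flow of a $C^\infty$ vector field $X$ such that (MS1) the non-wandering set consists of finitely many hyperbolic closed orbits; (MS2) the restriction $X|_{\partial M}$ is Morse-Smale (finitely many hyperbolic closed orbits forming the non-wandering set, with transverse stable and unstable manifolds); (MS3) for any closed orbits $O,O'$ in the non-wandering set and any point $x\in W^s(O)\cap W^u(O')$ at which the intersection is not transverse, one has $x\in\partial M$ and $O$ or $O'$ is singular. Here $W^s(A)=\{x:\omega(x)\subseteq A\}$ and $W^u(A)=\{x:\alpha(x)\subseteq A\}$. A limit cycle is a periodic orbit which is the $\alpha$- or $\omega$-limit set of a point not on it. A Morse flow is a Morse-Smale flow without limit cycles. *)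

theory Defs
  imports "HOL-Analysis.Analysis"
begin

section \<open>Quotient spaces\<close>

text \<open>The quotient of \<open>X\<close> by the partition whose class map is \<open>c\<close>.
  Its points are the classes \<open>c x\<close>, and a set of classes is open iff its preimage is.\<close>

definition quotient_space :: "'a topology \<Rightarrow> ('a \<Rightarrow> 'b) \<Rightarrow> 'b topology" where
  "quotient_space X c = topology (\<lambda>U. U \<subseteq> c ` topspace X \<and> openin X {x \<in> topspace X. c x \<in> U})"

lemma openin_quotient_space:
  "openin (quotient_space X c) U \<longleftrightarrow>
     U \<subseteq> c ` topspace X \<and> openin X {x \<in> topspace X. c x \<in> U}"
proof -
  have "istopology (\<lambda>U. U \<subseteq> c ` topspace X \<and> openin X {x \<in> topspace X. c x \<in> U})"
    unfolding istopology_def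
  proof (rule conjI)
    have "{x \<in> topspace X. c x \<in> S \<inter> T}
        = {x \<in> topspace X. c x \<in> S} \<inter> {x \<in> topspace X. c x \<in> T}" for S T
      by auto
    then show "\<forall>S T. S \<subseteq> c ` topspace X \<and> openin X {x \<in> topspace X. c x \<in> S} \<longrightarrow>
        T \<subseteq> c ` topspace X \<and> openin X {x \<in> topspace X. c x \<in> T} \<longrightarrow>
        S \<inter> T \<subseteq> c ` topspace X \<and> openin X {x \<in> topspace X. c x \<in> S \<inter> T}"
      by (simp add: openin_Int le_infI1)
  next
    have "{x \<in> topspace X. c x \<in> \<Union>\<K>} = (\<Union>K\<in>\<K>. {x \<in> topspace X. c x \<in> K})" for \<K>
      by auto
    then show "\<forall>\<K>. (\<forall>K\<in>\<K>. K \<subseteq> c ` topspace X \<and> openin X {x \<in> topspace X. c x \<in> K}) \<longrightarrow>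
        \<Union>\<K> \<subseteq> c ` topspace X \<and> openin X {x \<in> topspace X. c x \<in> \<Union>\<K>}"
      by (auto simp only: Sup_le_iff intro!: openin_Union)
  qed
  then show ?thesis unfolding quotient_space_def by (simp only: topology_inverse')
qed

lemma topspace_quotient_space [simp]: "topspace (quotient_space X c) = c ` topspace X"
proof
  show "topspace (quotient_space X c) \<subseteq> c ` topspace X"
    using openin_topspace[of "quotient_space X c"] by (simp only: openin_quotient_space)
  have "{x \<in> topspace X. c x \<in> c ` topspace X} = topspace X" by auto
  then have "openin (quotient_space X c) (c ` topspace X)"
    by (simp add: openin_quotient_space)
  then show "c ` topspace X \<subseteq> topspace (quotient_space X c)"
    by (rule openin_subset)
qed

section \<open>Flows and abstract weak orbits\<close>

definition flow_on :: "'a topology \<Rightarrow> (real \<Rightarrow> 'a \<Rightarrow> 'a) \<Rightarrow> bool" where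
  "flow_on X u \<longleftrightarrow>
     continuous_map (prod_topology euclideanreal X) X (\<lambda>(t, x). u t x) \<and>
     (\<forall>x\<in>topspace X. u 0 x = x \<and> (\<forall>s t. u (s + t) x = u s (u t x)))"

definition orbit_of :: "(real \<Rightarrow> 'a \<Rightarrow> 'a) \<Rightarrow> 'a \<Rightarrow> 'a set" where
  "orbit_of u x = range (\<lambda>t. u t x)"

definition omega_lim :: "'a topology \<Rightarrow> (real \<Rightarrow> 'a \<Rightarrow> 'a) \<Rightarrow> 'a \<Rightarrow> 'a set" where
  "omega_lim X u x = (\<Inter>n::real. X closure_of ((\<lambda>t. u t x) ` {n<..}))"

definition alpha_lim :: "'a topology \<Rightarrow> (real \<Rightarrow> 'a \<Rightarrow> 'a) \<Rightarrow> 'a \<Rightarrow> 'a set" where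
  "alpha_lim X u x = (\<Inter>n::real. X closure_of ((\<lambda>t. u t x) ` {..<n}))"

definition omega_lim' :: "'a topology \<Rightarrow> (real \<Rightarrow> 'a \<Rightarrow> 'a) \<Rightarrow> 'a \<Rightarrow> 'a set" where
  "omega_lim' X u x = omega_lim X u x - orbit_of u x"

definition alpha_lim' :: "'a topology \<Rightarrow> (real \<Rightarrow> 'a \<Rightarrow> 'a) \<Rightarrow> 'a \<Rightarrow> 'a set" where
  "alpha_lim' X u x = alpha_lim X u x - orbit_of u x"

definition Sing :: "'a topology \<Rightarrow> (real \<Rightarrow> 'a \<Rightarrow> 'a) \<Rightarrow> 'a set" where
  "Sing X u = {x \<in> topspace X. \<forall>t. u t x = x}"

definition Per :: "'a topology \<Rightarrow> (real \<Rightarrow> 'a \<Rightarrow> 'a) \<Rightarrow> 'a set" where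
  "Per X u = {x \<in> topspace X. x \<notin> Sing X u \<and> (\<exists>T>0. u T x = x)}"

definition recurrent :: "'a topology \<Rightarrow> (real \<Rightarrow> 'a \<Rightarrow> 'a) \<Rightarrow> 'a set" where
  "recurrent X u = {x \<in> topspace X. x \<in> alpha_lim X u x \<union> omega_lim X u x}"

definition R_set :: "'a topology \<Rightarrow> (real \<Rightarrow> 'a \<Rightarrow> 'a) \<Rightarrow> 'a set" where
  "R_set X u = recurrent X u - (Sing X u \<union> Per X u)"

definition P_set :: "'a topology \<Rightarrow> (real \<Rightarrow> 'a \<Rightarrow> 'a) \<Rightarrow> 'a set" where
  "P_set X u = topspace X - recurrent X u"

definition closed_orbits :: "'a topology \<Rightarrow> (real \<Rightarrow> 'a \<Rightarrow> 'a) \<Rightarrow> 'a set set" where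
  "closed_orbits X u = orbit_of u ` (Sing X u \<union> Per X u)"

definition stratum :: "'a topology \<Rightarrow> (real \<Rightarrow> 'a \<Rightarrow> 'a) \<Rightarrow> 'a \<Rightarrow> 'a set" where
  "stratum X u x =
     (if x \<in> Sing X u then Sing X u
      else if x \<in> Per X u then Per X u
      else if x \<in> P_set X u then P_set X u
      else R_set X u)"

definition weak_orbit1 :: "'a topology \<Rightarrow> (real \<Rightarrow> 'a \<Rightarrow> 'a) \<Rightarrow> 'a \<Rightarrow> 'a set" where
  "weak_orbit1 X u x =
     connected_component_of_set
       (subtopology X {y \<in> topspace X. alpha_lim' X u y = alpha_lim' X u x \<and>
                                       omega_lim' X u y = omega_lim' X u x}) x"

definition weak_orbit2 :: "'a topology \<Rightarrow> (real \<Rightarrow> 'a \<Rightarrow> 'a) \<Rightarrow> 'a \<Rightarrow> 'a set" where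
  "weak_orbit2 X u x =
     connected_component_of_set (subtopology X (weak_orbit1 X u x \<inter> stratum X u x)) x"

definition weak_orbit :: "'a topology \<Rightarrow> (real \<Rightarrow> 'a \<Rightarrow> 'a) \<Rightarrow> 'a \<Rightarrow> 'a set" where
  "weak_orbit X u x =
     (if x \<in> R_set X u
      then {y \<in> topspace X. X closure_of (orbit_of u y) = X closure_of (orbit_of u x) \<and>
                            alpha_lim X u y = alpha_lim X u x \<and>
                            omega_lim X u y = omega_lim X u x}
      else weak_orbit2 X u x)"

definition weak_orbit_space :: "'a topology \<Rightarrow> (real \<Rightarrow> 'a \<Rightarrow> 'a) \<Rightarrow> 'a set topology" where
  "weak_orbit_space X u = quotient_space X (weak_orbit X u)"

section \<open>Mapping tori and abstract weak orbits of homeomorphisms\<close>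

definition int_iter :: "'a topology \<Rightarrow> ('a \<Rightarrow> 'a) \<Rightarrow> int \<Rightarrow> 'a \<Rightarrow> 'a" where
  "int_iter X f n =
     (if 0 \<le> n then f ^^ nat n else inv_into (topspace X) f ^^ nat (- n))"

definition torus_class :: "'a topology \<Rightarrow> ('a \<Rightarrow> 'a) \<Rightarrow> 'a \<times> real \<Rightarrow> ('a \<times> real) set" where
  "torus_class X f p = {(int_iter X f n (fst p), snd p - of_int n) | n. True}"

definition mapping_torus :: "'a topology \<Rightarrow> ('a \<Rightarrow> 'a) \<Rightarrow> ('a \<times> real) set topology" where
  "mapping_torus X f = quotient_space (prod_topology X euclideanreal) (torus_class X f)"

text \<open>Translating every representative \<open>(y, s)\<close> of a class to \<open>(y, t + s)\<close> maps the
  class of \<open>(x, s)\<close> onto the class of \<open>(x, t + s)\<close>, so no choice of representative is needed.\<close>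

definition suspension :: "real \<Rightarrow> ('a \<times> real) set \<Rightarrow> ('a \<times> real) set" where
  "suspension t c = (\<lambda>(y, s). (y, t + s)) ` c"

lemma suspension_torus_class:
  "suspension t (torus_class X f (x, s)) = torus_class X f (x, t + s)"
  by (simp add: suspension_def torus_class_def full_SetCompr_eq image_image add_diff_eq)

definition weak_orbit_homeo :: "'a topology \<Rightarrow> ('a \<Rightarrow> 'a) \<Rightarrow> 'a \<Rightarrow> 'a set" where
  "weak_orbit_homeo X f x =
     {y \<in> topspace X. torus_class X f (y, 0) \<in>
        weak_orbit (mapping_torus X f) suspension (torus_class X f (x, 0))}"

definition weak_orbit_space_homeo :: "'a topology \<Rightarrow> ('a \<Rightarrow> 'a) \<Rightarrow> 'a set topology" where
  "weak_orbit_space_homeo X f = quotient_space X (weak_orbit_homeo X f)"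

section \<open>Smooth manifolds with boundary\<close>

primrec Ck_on :: "nat \<Rightarrow> ('e::euclidean_space \<Rightarrow> 'f::euclidean_space) \<Rightarrow> 'e set \<Rightarrow> bool" where
  "Ck_on 0 f S \<longleftrightarrow> continuous_on S f"
| "Ck_on (Suc k) f S \<longleftrightarrow>
     (\<forall>x\<in>S. f differentiable (at x)) \<and>
     (\<forall>v. Ck_on k (\<lambda>x. frechet_derivative f (at x) v) S)"

text \<open>\<open>Ck_on\<close> is meant for open sets. On an arbitrary set, smooth means locally extendable
  to a smooth function on an open subset of the ambient space.\<close>

definition smooth_on :: "'e::euclidean_space set \<Rightarrow> ('e \<Rightarrow> 'f::euclidean_space) \<Rightarrow> bool" where
  "smooth_on S f \<longleftrightarrow>
     (\<forall>x\<in>S. \<exists>W g. open W \<and> x \<in> W \<and> (\<forall>k. Ck_on k g W) \<and> (\<forall>y\<in>W \<inter> S. g y = f y))"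

text \<open>A chart is a pair of its domain and its coordinate map; the values of the coordinate
  map outside the domain are irrelevant.\<close>

type_synonym ('a, 'e) chart = "'a set \<times> ('a \<Rightarrow> 'e)"

definition coord_inv :: "('a, 'e) chart \<Rightarrow> 'e \<Rightarrow> 'a" where
  "coord_inv c = inv_into (fst c) (snd c)"

text \<open>The model of dimension \<open>n\<close> is an \<open>n\<close>-dimensional linear subspace \<open>man_model\<close> of a
  Euclidean space (so that \<open>n = 0\<close> is allowed), cut down to the half-space with inner normal
  \<open>man_normal\<close>. For the normal \<open>0\<close> the half-space is the whole model, and the manifold has
  no boundary.\<close>

record ('a, 'e) manifold =
  man_top :: "'a topology"
  man_model :: "'e set"
  man_normal :: 'e
  man_atlas :: "('a, 'e) chart set"

definition half_space :: "('a, 'e::euclidean_space) manifold \<Rightarrow> 'e set" where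
  "half_space M = {y \<in> man_model M. 0 \<le> y \<bullet> man_normal M}"

definition smooth_manifold :: "('a, 'e::euclidean_space) manifold \<Rightarrow> bool" where
  "smooth_manifold M \<longleftrightarrow>
     Hausdorff_space (man_top M) \<and> second_countable (man_top M) \<and>
     subspace (man_model M) \<and> man_normal M \<in> man_model M \<and>
     (\<Union>c\<in>man_atlas M. fst c) = topspace (man_top M) \<and>
     (\<forall>c\<in>man_atlas M.
        openin (man_top M) (fst c) \<and>
        openin (top_of_set (half_space M)) (snd c ` fst c) \<and>
        homeomorphic_map (subtopology (man_top M) (fst c)) (top_of_set (snd c ` fst c)) (snd c)) \<and>
     (\<forall>c\<in>man_atlas M. \<forall>d\<in>man_atlas M.
        smooth_on (snd c ` (fst c \<inter> fst d)) (snd d \<circ> coord_inv c))"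

definition man_boundary :: "('a, 'e::euclidean_space) manifold \<Rightarrow> 'a set" where
  "man_boundary M =
     {p. man_normal M \<noteq> 0 \<and> (\<exists>c\<in>man_atlas M. p \<in> fst c \<and> snd c p \<bullet> man_normal M = 0)}"

text \<open>Coordinates, in any chart, of the vectors tangent to the boundary at a boundary point.\<close>

definition boundary_model :: "('a, 'e::euclidean_space) manifold \<Rightarrow> 'e set" where
  "boundary_model M = {v \<in> man_model M. v \<bullet> man_normal M = 0}"

text \<open>A vector field is given by its coordinate vectors \<open>\<xi> c p\<close> in all charts \<open>c\<close> at \<open>p\<close>,
  which are related by the derivatives of the transition maps.\<close>

type_synonym ('a, 'e) vfield = "('a, 'e) chart \<Rightarrow> 'a \<Rightarrow> 'e"

definition smooth_vfield :: "('a, 'e::euclidean_space) manifold \<Rightarrow> ('a, 'e) vfield \<Rightarrow> bool" where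
  "smooth_vfield M \<xi> \<longleftrightarrow>
     (\<forall>c\<in>man_atlas M.
        (\<forall>p\<in>fst c. \<xi> c p \<in> man_model M) \<and>
        smooth_on (snd c ` fst c) (\<lambda>y. \<xi> c (coord_inv c y))) \<and>
     (\<forall>c\<in>man_atlas M. \<forall>d\<in>man_atlas M. \<forall>p\<in>fst c \<inter> fst d.
        \<exists>L. ((snd d \<circ> coord_inv c) has_derivative L)
               (at (snd c p) within snd c ` (fst c \<inter> fst d)) \<and>
            L (\<xi> c p) = \<xi> d p)"

definition flow_of_vfield ::
  "('a, 'e::euclidean_space) manifold \<Rightarrow> ('a, 'e) vfield \<Rightarrow> (real \<Rightarrow> 'a \<Rightarrow> 'a) \<Rightarrow> bool" where
  "flow_of_vfield M \<xi> w \<longleftrightarrow>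
     flow_on (man_top M) w \<and>
     (\<forall>x\<in>topspace (man_top M). \<forall>t. \<forall>c\<in>man_atlas M. w t x \<in> fst c \<longrightarrow>
        ((\<lambda>s. snd c (w s x)) has_vector_derivative \<xi> c (w t x)) (at t))"

section \<open>Morse-Smale flows\<close>

text \<open>The complex number \<open>l\<close> is an eigenvalue of the complexification of the endomorphism
  of \<open>F / K\<close> induced by the real linear map \<open>L\<close>, with eigenvector the class of
  \<open>a + \<i> b\<close>.\<close>

definition quotient_eigenvalue ::
  "'e::euclidean_space set \<Rightarrow> 'e set \<Rightarrow> ('e \<Rightarrow> 'e) \<Rightarrow> complex \<Rightarrow> bool" where
  "quotient_eigenvalue F K L l \<longleftrightarrow>
     (\<exists>a\<in>F. \<exists>b\<in>F. \<not> (a \<in> K \<and> b \<in> K) \<and>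
        L a - (Re l *\<^sub>R a - Im l *\<^sub>R b) \<in> K \<and>
        L b - (Im l *\<^sub>R a + Re l *\<^sub>R b) \<in> K)"

text \<open>In the rest of this section \<open>(Y, F)\<close> is \<open>(man_top M, man_model M)\<close> or the boundary of
  \<open>M\<close> with \<open>boundary_model M\<close>; \<open>F\<close> consists of the coordinates of the tangent vectors
  of \<open>Y\<close>. The map \<open>L\<close> below is the derivative in coordinates on \<open>M\<close>, which is
  uniquely determined on \<open>man_model M\<close>; the derivative on \<open>Y\<close> is its restriction to \<open>F\<close>.\<close>

text \<open>Singular points: no eigenvalue of the linear part lies on the imaginary axis.\<close>

definition hyperbolic_singular ::
  "('a, 'e::euclidean_space) manifold \<Rightarrow> ('a, 'e) vfield \<Rightarrow> 'e set \<Rightarrow> 'a \<Rightarrow> bool" where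
  "hyperbolic_singular M \<xi> F p \<longleftrightarrow>
     (\<forall>c\<in>man_atlas M. p \<in> fst c \<longrightarrow>
        (\<exists>L. ((\<lambda>y. \<xi> c (coord_inv c y)) has_derivative L) (at (snd c p) within snd c ` fst c) \<and>
             (\<forall>l. quotient_eigenvalue F {0} L l \<longrightarrow> Re l \<noteq> 0)))"

text \<open>Periodic points of least period \<open>T\<close>: the map induced by the derivative of the
  time-\<open>T\<close> map on the tangent space modulo the flow direction is the derivative of the
  Poincare return map; none of its eigenvalues lies on the unit circle.\<close>

definition hyperbolic_periodic ::
  "('a, 'e::euclidean_space) manifold \<Rightarrow> ('a, 'e) vfield \<Rightarrow> (real \<Rightarrow> 'a \<Rightarrow> 'a) \<Rightarrow> 'e set \<Rightarrow> 'a \<Rightarrow> bool"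
  where
  "hyperbolic_periodic M \<xi> w F p \<longleftrightarrow>
     (\<exists>T>0. w T p = p \<and> (\<forall>t. 0 < t \<and> t < T \<longrightarrow> w t p \<noteq> p) \<and>
       (\<forall>c\<in>man_atlas M. p \<in> fst c \<longrightarrow>
        (\<exists>L. ((\<lambda>y. snd c (w T (coord_inv c y))) has_derivative L)
                (at (snd c p) within snd c ` fst c) \<and>
             (\<forall>l. quotient_eigenvalue F (span {\<xi> c p}) L l \<longrightarrow> cmod l \<noteq> 1))))"

definition hyperbolic_closed_orbits ::
  "('a, 'e::euclidean_space) manifold \<Rightarrow> ('a, 'e) vfield \<Rightarrow> (real \<Rightarrow> 'a \<Rightarrow> 'a) \<Rightarrow>
     'a topology \<Rightarrow> 'e set \<Rightarrow> 'a set set" where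
  "hyperbolic_closed_orbits M \<xi> w Y F =
     {C \<in> closed_orbits Y w.
        \<forall>p\<in>C. (p \<in> Sing Y w \<longrightarrow> hyperbolic_singular M \<xi> F p) \<and>
              (p \<in> Per Y w \<longrightarrow> hyperbolic_periodic M \<xi> w F p)}"

definition nonwandering :: "'a topology \<Rightarrow> (real \<Rightarrow> 'a \<Rightarrow> 'a) \<Rightarrow> 'a set" where
  "nonwandering X u =
     {x \<in> topspace X. \<forall>U. openin X U \<and> x \<in> U \<longrightarrow> (\<forall>T. \<exists>t>T. u t ` U \<inter> U \<noteq> {})}"

definition finitely_many_hyperbolic ::
  "('a, 'e::euclidean_space) manifold \<Rightarrow> ('a, 'e) vfield \<Rightarrow> (real \<Rightarrow> 'a \<Rightarrow> 'a) \<Rightarrow>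
     'a topology \<Rightarrow> 'e set \<Rightarrow> bool" where
  "finitely_many_hyperbolic M \<xi> w Y F \<longleftrightarrow>
     (\<exists>\<C>. finite \<C> \<and> \<C> \<subseteq> hyperbolic_closed_orbits M \<xi> w Y F \<and> nonwandering Y w = \<Union>\<C>)"

definition stable_set :: "'a topology \<Rightarrow> (real \<Rightarrow> 'a \<Rightarrow> 'a) \<Rightarrow> 'a set \<Rightarrow> 'a set" where
  "stable_set X u A = {x \<in> topspace X. omega_lim X u x \<subseteq> A}"

definition unstable_set :: "'a topology \<Rightarrow> (real \<Rightarrow> 'a \<Rightarrow> 'a) \<Rightarrow> 'a set \<Rightarrow> 'a set" where
  "unstable_set X u A = {x \<in> topspace X. alpha_lim X u x \<subseteq> A}"

text \<open>The tangent space at \<open>x\<close>, in the coordinates of the chart \<open>c\<close>, of the stable manifold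
  of a hyperbolic closed orbit \<open>C\<close> as an immersed submanifold: the span of the initial
  velocities of curves from \<open>x\<close> in the stable set. Curves continuous for the topology of \<open>Y\<close>
  may leave the immersed submanifold through a point where it accumulates on itself; the
  curves that do not are those along which the convergence to \<open>C\<close> is uniform, that is, which
  are carried into a local stable manifold of \<open>C\<close> by the flow. Velocities are
  one-sided because stable manifolds may have boundary on the boundary of \<open>M\<close>.\<close>

definition stable_tangent ::
  "('a, 'e::euclidean_space) chart \<Rightarrow> 'a topology \<Rightarrow> (real \<Rightarrow> 'a \<Rightarrow> 'a) \<Rightarrow> 'a set \<Rightarrow> 'a \<Rightarrow> 'e set"
  where
  "stable_tangent c Y u C x =
     span {v. \<exists>\<gamma> e. 0 < e \<and> \<gamma> 0 = x \<and>
                \<gamma> ` {0..e} \<subseteq> fst c \<inter> stable_set Y u C \<and>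
                (\<forall>N. openin Y N \<and> C \<subseteq> N \<longrightarrow> (\<exists>T. \<forall>t\<ge>T. \<forall>s\<in>{0..e}. u t (\<gamma> s) \<in> N)) \<and>
                ((\<lambda>s. snd c (\<gamma> s)) has_vector_derivative v) (at 0 within {0..e})}"

definition unstable_tangent ::
  "('a, 'e::euclidean_space) chart \<Rightarrow> 'a topology \<Rightarrow> (real \<Rightarrow> 'a \<Rightarrow> 'a) \<Rightarrow> 'a set \<Rightarrow> 'a \<Rightarrow> 'e set"
  where
  "unstable_tangent c Y u C x = stable_tangent c Y (\<lambda>t. u (- t)) C x"

definition transverse_at ::
  "('a, 'e::euclidean_space) manifold \<Rightarrow> (real \<Rightarrow> 'a \<Rightarrow> 'a) \<Rightarrow> 'a topology \<Rightarrow> 'e set \<Rightarrow>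
     'a set \<Rightarrow> 'a set \<Rightarrow> 'a \<Rightarrow> bool" where
  "transverse_at M w Y F C C' x \<longleftrightarrow>
     (\<forall>c\<in>man_atlas M. x \<in> fst c \<longrightarrow>
        {a + b | a b. a \<in> stable_tangent c Y w C x \<and> b \<in> unstable_tangent c Y w C' x} = F)"

definition morse_smale_vfield ::
  "('a, 'e::euclidean_space) manifold \<Rightarrow> ('a, 'e) vfield \<Rightarrow> (real \<Rightarrow> 'a \<Rightarrow> 'a) \<Rightarrow> bool" where
  "morse_smale_vfield M \<xi> w \<longleftrightarrow>
     smooth_vfield M \<xi> \<and> flow_of_vfield M \<xi> w \<and>
     finitely_many_hyperbolic M \<xi> w (man_top M) (man_model M) \<and>
     (let Y = subtopology (man_top M) (man_boundary M); F = boundary_model M in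
        finitely_many_hyperbolic M \<xi> w Y F \<and>
        (\<forall>C\<in>closed_orbits Y w. \<forall>C'\<in>closed_orbits Y w.
           C \<subseteq> nonwandering Y w \<and> C' \<subseteq> nonwandering Y w \<longrightarrow>
           (\<forall>x\<in>stable_set Y w C \<inter> unstable_set Y w C'. transverse_at M w Y F C C' x))) \<and>
     (let Y = man_top M; F = man_model M in
        \<forall>C\<in>closed_orbits Y w. \<forall>C'\<in>closed_orbits Y w.
          C \<subseteq> nonwandering Y w \<and> C' \<subseteq> nonwandering Y w \<longrightarrow>
          (\<forall>x\<in>stable_set Y w C \<inter> unstable_set Y w C'. \<not> transverse_at M w Y F C C' x \<longrightarrow>
             x \<in> man_boundary M \<and> (C \<subseteq> Sing Y w \<or> C' \<subseteq> Sing Y w)))"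

text \<open>A strictly increasing bijection of the reals is an orientation-preserving homeomorphism.\<close>

definition topologically_equivalent ::
  "'a topology \<Rightarrow> (real \<Rightarrow> 'a \<Rightarrow> 'a) \<Rightarrow> (real \<Rightarrow> 'a \<Rightarrow> 'a) \<Rightarrow> bool" where
  "topologically_equivalent X u w \<longleftrightarrow>
     (\<exists>h. homeomorphic_map X X h \<and>
        (\<forall>x\<in>topspace X. \<exists>\<theta>. strict_mono \<theta> \<and> surj \<theta> \<and> (\<forall>t. h (u t x) = w (\<theta> t) (h x))))"

definition morse_smale_flow ::
  "('a, 'e::euclidean_space) manifold \<Rightarrow> (real \<Rightarrow> 'a \<Rightarrow> 'a) \<Rightarrow> bool" where
  "morse_smale_flow M v \<longleftrightarrow>
     flow_on (man_top M) v \<and>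
     (\<exists>\<xi> w. morse_smale_vfield M \<xi> w \<and> topologically_equivalent (man_top M) v w)"

definition limit_cycle :: "'a topology \<Rightarrow> (real \<Rightarrow> 'a \<Rightarrow> 'a) \<Rightarrow> 'a set \<Rightarrow> bool" where
  "limit_cycle X u C \<longleftrightarrow>
     C \<in> orbit_of u ` Per X u \<and>
     (\<exists>x\<in>topspace X - C. alpha_lim X u x = C \<or> omega_lim X u x = C)"

definition morse_flow ::
  "('a, 'e::euclidean_space) manifold \<Rightarrow> (real \<Rightarrow> 'a \<Rightarrow> 'a) \<Rightarrow> bool" where
  "morse_flow M v \<longleftrightarrow> morse_smale_flow M v \<and> \<not> (\<exists>C. limit_cycle (man_top M) v C)"

end

theory Submission
  imports Defs "HOL-Analysis.Kronecker_Approximation_Theorem"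
begin

text \<open>The mapping torus of the time-one map \<open>v\<^sub>1\<close> is the product of \<open>M\<close> with the circle
  by \<open>[(x, t)] \<mapsto> (v\<^sub>t x, e\<^bsup>2\<pi>it\<^esup>)\<close>, which turns the suspension flow into the product of
  \<open>v\<close> with a rotation. In this product the abstract weak orbit of \<open>(x, z)\<close> is the abstract weak
  orbit of \<open>x\<close> times the circle, so the two partitions of \<open>M\<close> are equal. Only three properties of a
  Morse flow matter: there are finitely many closed orbits, all limit sets are closed orbits, and
  there are no limit cycles. They imply that a point on no closed orbit has singletons as limit
  sets, and the limit sets in the product are these times the circle. For a periodic point either
  the product orbit is periodic, and the class is the component of the periodic points; or the
  period is irrational, and the product orbit is dense in the torus over the orbit.\<close>

section \<open>Limit sets of flows\<close>

text \<open>The difficulty is that both coordinates of the product move with the same time, so a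
  limit set there can be smaller than the product of a limit set with the circle. If the first
  coordinate converges to one singular point, late times may be chosen freely to prescribe the
  phase, and the whole circle appears. Convergence to a limit cycle would leave no such freedom:
  with a period commensurable with the rotation, the limit set can be a single orbit that remembers
  an asymptotic phase. This is what the absence of limit cycles rules out. For closed orbits the
  periods are arbitrary, since topological equivalence does not preserve them. Commensurable and
  incommensurable periods fall under different clauses of \<open>weak_orbit\<close> in the product
  (a component of the periodic points, or equality of orbit closures and limit sets), and both
  clauses have to yield the same set. Statements on \<alpha>-limits come from those on
  \<omega>-limits by reversing time.\<close>

lemma alpha_lim_reverse: "alpha_lim X u x = omega_lim X (\<lambda>t. u (- t)) x"
proof -
  have "(\<lambda>t. u (- t) x) ` {n<..} = (\<lambda>t. u t x) ` {..<- n}" for n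
  proof -
    have "(\<lambda>t. u (- t) x) ` {n<..} = (\<lambda>t. u t x) ` uminus ` {n<..}"
      by (simp only: image_image)
    then show ?thesis by simp
  qed
  then have "omega_lim X (\<lambda>t. u (- t)) x
      = (\<Inter>m\<in>range (uminus :: real \<Rightarrow> real). X closure_of ((\<lambda>t. u t x) ` {..<m}))"
    by (simp only: omega_lim_def image_image)
  moreover have "range (uminus :: real \<Rightarrow> real) = UNIV" by simp
  ultimately show ?thesis by (simp only: alpha_lim_def)
qed

lemma orbit_of_reverse: "orbit_of (\<lambda>t. u (- t)) x = orbit_of u x"
proof -
  have "range (\<lambda>t. u (- t) x) = (\<lambda>t. u t x) ` range uminus"
    by (simp only: image_image)
  then show ?thesis by (simp add: orbit_of_def)
qed

lemma omega_lim_subset_topspace: "omega_lim X u x \<subseteq> topspace X"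
  unfolding omega_lim_def using closure_of_subset_topspace by fast

lemma alpha_lim_subset_topspace: "alpha_lim X u x \<subseteq> topspace X"
  unfolding alpha_lim_def using closure_of_subset_topspace by fast

lemma in_omega_lim_iff:
  "y \<in> omega_lim X u x \<longleftrightarrow>
     y \<in> topspace X \<and> (\<forall>U n. openin X U \<longrightarrow> y \<in> U \<longrightarrow> (\<exists>t>n. u t x \<in> U))"
  by (fastforce simp: omega_lim_def in_closure_of)

text \<open>A connected subset of \<open>A \<inter> B\<close> through \<open>x\<close> already lies
  in the component of \<open>x\<close> in \<open>A\<close>. This merges the two stages in the
  definition of \<open>weak_orbit2\<close> into a single component.\<close>

lemma connected_component_of_Int_connected_component_of:
  "connected_component_of_set
     (subtopology X (connected_component_of_set (subtopology X A) x \<inter> B)) x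
   = connected_component_of_set (subtopology X (A \<inter> B)) x" (is "?L = ?R")
proof
  have "connected_component_of_set (subtopology X A) x \<subseteq> A"
    using connected_component_of_subset_topspace by fastforce
  then show "?L \<subseteq> ?R"
    by (auto intro: connected_component_of_mono)
  show "?R \<subseteq> ?L"
  proof
    fix y assume "y \<in> ?R"
    then obtain T where T: "connectedin X T" "T \<subseteq> A \<inter> B" "x \<in> T" "y \<in> T"
      by (auto simp: connected_component_of_def connectedin_subtopology)
    then have "T \<subseteq> connected_component_of_set (subtopology X A) x"
      by (intro connected_component_of_maximal) (auto simp: connectedin_subtopology)
    with T show "y \<in> ?L"
      by (auto simp: connected_component_of_def connectedin_subtopology)
  qed
qed

lemma weak_orbit2_eq:
  "weak_orbit2 X u x =
     connected_component_of_set
       (subtopology X ({y \<in> topspace X. alpha_lim' X u y = alpha_lim' X u x \<and>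
                                         omega_lim' X u y = omega_lim' X u x} \<inter> stratum X u x)) x"
  unfolding weak_orbit2_def weak_orbit1_def
  by (rule connected_component_of_Int_connected_component_of)

section \<open>Elementary theory of flows: invariance, closed orbits, time reversal\<close>

locale topological_flow =
  fixes X :: "'a topology" and u :: "real \<Rightarrow> 'a \<Rightarrow> 'a"
  assumes flow: "flow_on X u"
begin

lemma flow_zero [simp]: "x \<in> topspace X \<Longrightarrow> u 0 x = x"
  and flow_add: "x \<in> topspace X \<Longrightarrow> u (s + t) x = u s (u t x)"
  using flow by (auto simp: flow_on_def)

lemma continuous_map_flow:
  "continuous_map (prod_topology euclideanreal X) X (\<lambda>(t, x). u t x)"
  using flow by (auto simp: flow_on_def)

lemma continuous_map_space: "continuous_map X X (u t)"
proof -
  have "continuous_map X (prod_topology euclideanreal X) (\<lambda>x. (t, x))"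
    by (simp add: continuous_map_paired)
  from continuous_map_compose[OF this continuous_map_flow] show ?thesis
    by (simp add: o_def)
qed

lemma continuous_map_time:
  assumes "x \<in> topspace X"
  shows "continuous_map euclideanreal X (\<lambda>t. u t x)"
proof -
  have "continuous_map euclideanreal (prod_topology euclideanreal X) (\<lambda>t. (t, x))"
    using assms by (simp add: continuous_map_paired)
  from continuous_map_compose[OF this continuous_map_flow] show ?thesis
    by (simp add: o_def)
qed

lemma flow_in_topspace [simp]: "x \<in> topspace X \<Longrightarrow> u t x \<in> topspace X"
  using continuous_map_space[of t] by (auto simp: continuous_map_def)

lemma orbit_subset_topspace: "x \<in> topspace X \<Longrightarrow> orbit_of u x \<subseteq> topspace X"
  by (auto simp: orbit_of_def)

lemma orbit_self: "x \<in> topspace X \<Longrightarrow> x \<in> orbit_of u x"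
  unfolding orbit_of_def by (metis flow_zero rangeI)

lemma orbit_eq:
  assumes "x \<in> topspace X" "y \<in> orbit_of u x"
  shows "orbit_of u y = orbit_of u x"
proof -
  obtain a where a: "y = u a x" using assms by (auto simp: orbit_of_def)
  have "u t x \<in> orbit_of u y" for t
    using flow_add[of x "t - a" a] assms a by (auto simp: orbit_of_def)
  moreover have "u t y \<in> orbit_of u x" for t
    using flow_add[of x t a] assms a unfolding orbit_of_def by (metis rangeI)
  ultimately show ?thesis by (auto simp: orbit_of_def)
qed

lemma connectedin_orbit: "x \<in> topspace X \<Longrightarrow> connectedin X (orbit_of u x)"
  unfolding orbit_of_def
  by (rule connectedin_continuous_map_image[OF continuous_map_time]) auto

lemma omega_lim_subset_closure_orbit: "omega_lim X u x \<subseteq> X closure_of orbit_of u x"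
proof -
  have "X closure_of ((\<lambda>t. u t x) ` {0<..}) \<subseteq> X closure_of orbit_of u x"
    by (rule closure_of_mono) (auto simp: orbit_of_def)
  then show ?thesis by (auto simp: omega_lim_def)
qed

lemma omega_lim_invariant:
  assumes x: "x \<in> topspace X" and y: "y \<in> omega_lim X u x"
  shows "u s y \<in> omega_lim X u x"
  unfolding in_omega_lim_iff
proof (intro conjI allI impI)
  have yX: "y \<in> topspace X" using y in_omega_lim_iff by metis
  then show "u s y \<in> topspace X" by simp
  fix U n assume U: "openin X U" "u s y \<in> U"
  have "openin X {z \<in> topspace X. u s z \<in> U}"
    using openin_continuous_map_preimage[OF continuous_map_space U(1)] .
  then obtain t where t: "t > n - s" "u t x \<in> {z \<in> topspace X. u s z \<in> U}"
    using y yX U by (auto simp: in_omega_lim_iff)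
  then have "u (s + t) x \<in> U" using flow_add[of x s t] x by simp
  then show "\<exists>t>n. u t x \<in> U" using t by (intro exI[of _ "s + t"]) auto
qed

lemma orbit_subset_omega_lim:
  assumes "x \<in> topspace X" "y \<in> omega_lim X u x"
  shows "orbit_of u y \<subseteq> omega_lim X u x"
  using omega_lim_invariant[OF assms] by (auto simp: orbit_of_def)

text \<open>A singular point returns at every time, so positive return times describe singular and
  periodic points at once.\<close>

lemma Cl_iff: "x \<in> Sing X u \<union> Per X u \<longleftrightarrow> x \<in> topspace X \<and> (\<exists>T>0. u T x = x)"
  by (auto simp: Sing_def Per_def intro: exI[of _ 1])

lemma return_multiple:
  assumes x: "x \<in> topspace X" "u T x = x"
  shows "u (of_int n * T) x = x"
proof -
  have nat: "u (real k * T) x = x" for k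
  proof (induction k)
    case (Suc k)
    have "real (Suc k) * T = T + real k * T" by (simp add: algebra_simps)
    then show ?case using flow_add[OF x(1), of T "real k * T"] Suc x by simp
  qed (use x in simp)
  show ?thesis
  proof (cases "n \<ge> 0")
    case True
    then show ?thesis using nat[of "nat n"] by simp
  next
    case False
    have "u (real (nat (- n)) * T + of_int n * T) x = u (of_int n * T) x"
      using flow_add[OF x(1), of "of_int n * T" "real (nat (- n)) * T"] nat[of "nat (- n)"]
      by (simp add: add.commute)
    moreover have "real (nat (- n)) * T + of_int n * T = 0" using False by simp
    ultimately show ?thesis using x by simp
  qed
qed

lemma return_orbit:
  assumes "x \<in> topspace X" "u T x = x" "y \<in> orbit_of u x"
  shows "u T y = y"
proof -
  obtain a where a: "y = u a x" using assms by (auto simp: orbit_of_def)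
  then show ?thesis
    using flow_add[of x T a] flow_add[of x a T] assms by (simp add: add.commute)
qed

lemma Sing_orbit: "x \<in> Sing X u \<Longrightarrow> orbit_of u x = {x}"
  by (auto simp: Sing_def orbit_of_def)

lemma Per_orbit:
  assumes "x \<in> Per X u" "y \<in> orbit_of u x"
  shows "y \<in> Per X u"
proof -
  have xX: "x \<in> topspace X" using assms(1) by (auto simp: Per_def)
  obtain T where "T > 0" "u T x = x" using assms(1) by (auto simp: Per_def)
  then have "y \<in> Sing X u \<union> Per X u"
    using return_orbit[OF xX _ assms(2)] orbit_subset_topspace[OF xX] assms(2) Cl_iff by blast
  moreover have "y \<notin> Sing X u"
    using Sing_orbit[of y] orbit_eq[OF xX assms(2)] orbit_self[OF xX] assms(1)
    by (auto simp: Per_def)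
  ultimately show ?thesis by simp
qed

lemma closed_orbit_points:
  assumes "x \<in> Sing X u \<union> Per X u" "y \<in> orbit_of u x"
  shows "y \<in> Sing X u \<union> Per X u"
proof (cases "x \<in> Sing X u")
  case True
  then show ?thesis using Sing_orbit[OF True] assms by simp
next
  case False
  then show ?thesis using Per_orbit assms by simp
qed

lemma compactin_closed_orbit:
  assumes "x \<in> Sing X u \<union> Per X u"
  shows "compactin X (orbit_of u x)"
proof -
  obtain T where T: "T > 0" "u T x = x" and x: "x \<in> topspace X" using assms Cl_iff by blast
  have "u t x \<in> (\<lambda>t. u t x) ` {0..T}" for t
  proof
    let ?n = "\<lfloor>t / T\<rfloor>"
    have "u ((t - of_int ?n * T) + of_int ?n * T) x = u (t - of_int ?n * T) x"
      unfolding flow_add[OF x] return_multiple[OF x T(2)] by simp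
    then show "u t x = u (t - of_int ?n * T) x" by simp
    have "of_int ?n * T \<le> t / T * T" "t / T * T \<le> (of_int ?n + 1) * T"
      using T(1) by (intro mult_right_mono; linarith)+
    then show "t - of_int ?n * T \<in> {0..T}" using T(1) by (simp add: algebra_simps)
  qed
  then have "orbit_of u x = (\<lambda>t. u t x) ` {0..T}" by (auto simp: orbit_of_def)
  then show ?thesis
    using image_compactin[OF _ continuous_map_time[OF x], of "{0..T}"] by simp
qed

lemma orbit_subset_omega_lim_closed_orbit:
  assumes "x \<in> Sing X u \<union> Per X u"
  shows "orbit_of u x \<subseteq> omega_lim X u x"
proof
  obtain T where T: "T > 0" "u T x = x" and x: "x \<in> topspace X" using assms Cl_iff by blast
  fix y assume "y \<in> orbit_of u x"
  then obtain a where a: "y = u a x" by (auto simp: orbit_of_def)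
  show "y \<in> omega_lim X u x"
    unfolding in_omega_lim_iff
  proof (intro conjI allI impI)
    show "y \<in> topspace X" using a x by simp
    fix U n assume U: "openin X U" "y \<in> U"
    obtain k :: nat where k: "real k > (n - a) / T" using reals_Archimedean2 by blast
    have "u (a + of_int (int k) * T) x = y"
      unfolding flow_add[OF x] return_multiple[OF x T(2)] using a by simp
    moreover have "a + of_int (int k) * T > n" using k T by (simp add: field_simps)
    ultimately show "\<exists>t>n. u t x \<in> U" using U by metis
  qed
qed

text \<open>A closed orbit is the image of a compact time interval, hence closed in a Hausdorff
  space; conversely each of its points is revisited at arbitrarily late times.\<close>

lemma omega_lim_closed_orbit:
  assumes "Hausdorff_space X" and x: "x \<in> Sing X u \<union> Per X u"
  shows "omega_lim X u x = orbit_of u x"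
proof
  have "closedin X (orbit_of u x)"
    using compactin_imp_closedin assms compactin_closed_orbit by blast
  then show "omega_lim X u x \<subseteq> orbit_of u x"
    using omega_lim_subset_closure_orbit closure_of_closedin by fastforce
qed (rule orbit_subset_omega_lim_closed_orbit[OF x])

text \<open>Together with \<open>alpha_lim_reverse\<close> this turns every result on
  \<omega>-limits into one on \<alpha>-limits.\<close>

lemma reverse: "topological_flow X (\<lambda>t. u (- t))"
proof
  have "continuous_map (prod_topology euclideanreal X) (prod_topology euclideanreal X)
      (\<lambda>p. (- fst p, snd p))"
    by (intro continuous_map_pairedI continuous_map_snd)
       (simp add: continuous_map_fst continuous_map_minus)
  from continuous_map_compose[OF this continuous_map_flow]
  have "continuous_map (prod_topology euclideanreal X) X (\<lambda>(t, x). u (- t) x)"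
    by (simp add: o_def case_prod_unfold)
  moreover have "u (- (s + t)) x = u (- s) (u (- t) x)" if "x \<in> topspace X" for s t x
    using flow_add[OF that, of "- s" "- t"] by (simp add: add.commute)
  ultimately show "flow_on X (\<lambda>t. u (- t))"
    by (simp add: flow_on_def)
qed

lemma Sing_reverse: "Sing X (\<lambda>t. u (- t)) = Sing X u"
  unfolding Sing_def by (metis minus_minus)

lemma Cl_reverse: "Sing X (\<lambda>t. u (- t)) \<union> Per X (\<lambda>t. u (- t)) = Sing X u \<union> Per X u"
proof -
  interpret r: topological_flow X "\<lambda>t. u (- t)" by (rule reverse)
  have "u (- T) x = x \<longleftrightarrow> u T x = x" if "x \<in> topspace X" for T x
    using return_multiple[OF that, of T "- 1"] return_multiple[OF that, of "- T" "- 1"] by auto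
  then show ?thesis using Cl_iff r.Cl_iff by (intro set_eqI) auto
qed

lemma Per_reverse: "Per X (\<lambda>t. u (- t)) = Per X u"
proof -
  have "Per X w = (Sing X w \<union> Per X w) - Sing X w" for w by (auto simp: Per_def)
  then show ?thesis using Sing_reverse Cl_reverse by metis
qed

lemma closed_orbits_reverse: "closed_orbits X (\<lambda>t. u (- t)) = closed_orbits X u"
  by (simp add: closed_orbits_def Cl_reverse orbit_of_reverse cong: image_cong)

lemma alpha_lim_closed_orbit:
  assumes "Hausdorff_space X" and x: "x \<in> Sing X u \<union> Per X u"
  shows "alpha_lim X u x = orbit_of u x"
  using topological_flow.omega_lim_closed_orbit[OF reverse assms(1), of x] x
  by (simp add: Cl_reverse alpha_lim_reverse orbit_of_reverse del: Un_iff)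

lemma nonwandering_reverse: "nonwandering X (\<lambda>t. u (- t)) = nonwandering X u"
proof -
  have "u (- t) ` U \<inter> U \<noteq> {} \<longleftrightarrow> u t ` U \<inter> U \<noteq> {}" if U: "openin X U" for t U
  proof -
    have *: "u (- t) ` U \<inter> U \<noteq> {}" if "u t ` U \<inter> U \<noteq> {}" for t
    proof -
      obtain z where z: "z \<in> U" "u t z \<in> U" using \<open>u t ` U \<inter> U \<noteq> {}\<close> by auto
      then have "z \<in> topspace X" using U openin_subset by blast
      then have "u (- t) (u t z) = z" using flow_add[of z "- t" t] by simp
      then show ?thesis using z by (metis IntI empty_iff image_eqI)
    qed
    show ?thesis using *[of t] *[of "- t"] by auto
  qed
  then show ?thesis unfolding nonwandering_def by auto
qed

end

section \<open>Limit sets in compact Hausdorff spaces\<close>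

locale compact_flow = topological_flow +
  assumes compact: "compact_space X" and Hausdorff: "Hausdorff_space X"
begin

lemma reverse_compact: "compact_flow X (\<lambda>t. u (- t))"
  by (simp add: compact_flow.intro compact_flow_axioms.intro reverse compact Hausdorff)

lemma closedin_closed_orbit: "C \<in> closed_orbits X u \<Longrightarrow> closedin X C"
  unfolding closed_orbits_def using compactin_imp_closedin[OF Hausdorff] compactin_closed_orbit
  by blast

lemma disjoint_closed_orbits:
  assumes "C \<in> closed_orbits X u" "D \<in> closed_orbits X u" "C \<noteq> D"
  shows "disjnt C D"
  using assms orbit_eq Cl_iff unfolding closed_orbits_def disjnt_iff by blast

text \<open>If the orbit left \<open>U\<close> at arbitrarily late times, the closures of its tails
  minus \<open>U\<close> would be nested nonempty closed sets. By compactness they would share a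
  point, which would be a limit point outside \<open>U\<close>.\<close>

lemma omega_lim_attracts:
  assumes x: "x \<in> topspace X" and U: "openin X U" "omega_lim X u x \<subseteq> U"
  shows "\<exists>T. \<forall>t>T. u t x \<in> U"
proof (rule ccontr)
  assume contra: "\<nexists>T. \<forall>t>T. u t x \<in> U"
  define A where "A n = X closure_of ((\<lambda>t. u t x) ` {real n<..}) - U" for n
  have "(\<Inter>n. A n) \<noteq> {}"
  proof (rule compact_space_imp_nest[OF compact])
    show "closedin X (A n)" for n unfolding A_def using U by (intro closedin_diff closedin_closure_of)
    show "decseq A"
      unfolding A_def decseq_def
      by (intro allI impI Diff_mono closure_of_mono image_mono order_refl) auto
    show "A n \<noteq> {}" for n
    proof -
      obtain t where t: "t > real n" "u t x \<notin> U" using contra by auto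
      have "(\<lambda>t. u t x) ` {real n<..} \<subseteq> X closure_of ((\<lambda>t. u t x) ` {real n<..})"
        using x by (intro closure_of_subset) auto
      with t show ?thesis by (auto simp: A_def)
    qed
  qed
  then obtain y where y: "\<And>n. y \<in> A n" by blast
  have "y \<in> omega_lim X u x"
    unfolding omega_lim_def
  proof
    fix r :: real
    obtain n :: nat where "real n > r" using reals_Archimedean2 by blast
    then have "X closure_of ((\<lambda>t. u t x) ` {real n<..}) \<subseteq> X closure_of ((\<lambda>t. u t x) ` {r<..})"
      by (intro closure_of_mono) auto
    then show "y \<in> X closure_of ((\<lambda>t. u t x) ` {r<..})" using y[of n] by (auto simp: A_def)
  qed
  then show False using y[of 0] U(2) by (auto simp: A_def)
qed

lemma omega_lim_nonempty: "x \<in> topspace X \<Longrightarrow> omega_lim X u x \<noteq> {}"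
  \<comment> \<open>An empty limit set would force the orbit into the empty set.\<close>
  using omega_lim_attracts[of x "{}"] using gt_ex by auto

lemma omega_lim_subset_nonwandering:
  assumes x: "x \<in> topspace X"
  shows "omega_lim X u x \<subseteq> nonwandering X u"
proof
  fix y assume y: "y \<in> omega_lim X u x"
  show "y \<in> nonwandering X u"
    unfolding nonwandering_def
  proof (intro CollectI conjI allI impI)
    show "y \<in> topspace X" using y in_omega_lim_iff by metis
    fix U T assume U: "openin X U \<and> y \<in> U"
    then obtain s where s: "u s x \<in> U" using y in_omega_lim_iff by metis
    \<comment> \<open>Two visits to \<open>U\<close> more than \<open>T\<close> apart: their time
      difference is the required return time.\<close>
    obtain r where r: "r > s + T" "u r x \<in> U" using U y in_omega_lim_iff by metis
    have "u (r - s) (u s x) = u r x" using flow_add[OF x, of "r - s" s] by simp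
    with s r have "u r x \<in> u (r - s) ` U \<inter> U" by (metis IntI image_eqI)
    with r show "\<exists>t>T. u t ` U \<inter> U \<noteq> {}" by (intro exI[of _ "r - s"]) auto
  qed
qed

lemma closed_orbit_subset_nonwandering:
  assumes "x \<in> Sing X u \<union> Per X u"
  shows "x \<in> nonwandering X u"
proof -
  have "x \<in> topspace X" using assms Cl_iff by blast
  then show ?thesis
    using omega_lim_subset_nonwandering omega_lim_closed_orbit[OF Hausdorff assms] orbit_self by blast
qed

text \<open>Members of \<open>K\<close> are disjoint compact sets, so one of them and the union of
  the others have disjoint neighbourhoods. A late tail of the orbit lies in these and is connected,
  so it stays near one member only.\<close>

lemma omega_lim_in_closed_orbits:
  assumes x: "x \<in> topspace X"
    and K: "finite K" "K \<subseteq> closed_orbits X u" "omega_lim X u x \<subseteq> \<Union>K"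
  shows "omega_lim X u x \<in> K"
proof -
  obtain y C where y: "y \<in> omega_lim X u x" "y \<in> C" "C \<in> K"
    using omega_lim_nonempty[OF x] K(3) by blast
  let ?D = "\<Union>(K - {C})"
  have "closedin X C" "closedin X ?D"
    using K y closedin_closed_orbit by (auto intro!: closedin_Union)
  moreover have "disjnt C ?D"
    unfolding disjnt_Union2
  proof
    fix D assume D: "D \<in> K - {C}"
    then have "D \<in> closed_orbits X u" "C \<in> closed_orbits X u" using K(2) y(3) by auto
    then show "disjnt C D" using D disjoint_closed_orbits by blast
  qed
  moreover have "normal_space X"
    using compact Hausdorff compact_Hausdorff_or_regular_imp_normal_space by blast
  ultimately obtain U V where UV: "openin X U" "openin X V" "C \<subseteq> U" "?D \<subseteq> V" "disjnt U V"
    unfolding normal_space_def by meson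
  have "omega_lim X u x \<subseteq> U \<union> V" using K(3) UV by blast
  then obtain T where T: "\<And>t. t > T \<Longrightarrow> u t x \<in> U \<union> V"
    using omega_lim_attracts[OF x, of "U \<union> V"] UV by blast
  let ?I = "(\<lambda>t. u t x) ` {T<..}"
  have "connectedin X ?I"
    by (rule connectedin_continuous_map_image[OF continuous_map_time[OF x]]) auto
  moreover have "?I \<subseteq> U \<union> V" using T by auto
  moreover have "?I \<inter> U \<noteq> {}"
  proof -
    obtain t where "t > T" "u t x \<in> U" using y UV in_omega_lim_iff by (metis subsetD)
    then show ?thesis by auto
  qed
  moreover have "U \<inter> V \<inter> ?I = {}" using UV by (auto simp: disjnt_iff)
  ultimately have disj: "V \<inter> ?I = {}"
    using UV(1,2) unfolding connectedin by (metis Int_commute)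
  have "omega_lim X u x \<inter> ?D = {}"
  proof (rule ccontr)
    assume "omega_lim X u x \<inter> ?D \<noteq> {}"
    then obtain z where "z \<in> omega_lim X u x" "z \<in> V" using UV by blast
    then obtain t where "t > T" "u t x \<in> V" using UV in_omega_lim_iff by metis
    then show False using disj by auto
  qed
  then have "omega_lim X u x \<subseteq> C" using K(3) by blast
  \<comment> \<open>Since \<open>C\<close> is the orbit of the limit point \<open>y\<close>,
    invariance of the limit set upgrades the inclusion in \<open>C\<close> to equality.\<close>
  moreover have "C = orbit_of u y"
  proof -
    obtain c where "c \<in> topspace X" "C = orbit_of u c"
      using K(2) y(3) Cl_iff unfolding closed_orbits_def by blast
    then show ?thesis using orbit_eq y by blast
  qed
  ultimately show ?thesis using orbit_subset_omega_lim[OF x y(1)] y by auto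
qed

text \<open>Closed orbits are nonwandering and pairwise disjoint, so \<open>K\<close> already
  contains all of them; limit sets are nonwandering too, hence members of \<open>K\<close>.\<close>

lemma finite_nonwandering_limits:
  assumes "finite K" "K \<subseteq> closed_orbits X u" "nonwandering X u = \<Union>K"
  shows "finite (closed_orbits X u)"
    and "x \<in> topspace X \<Longrightarrow> omega_lim X u x \<in> closed_orbits X u"
    and "x \<in> topspace X \<Longrightarrow> alpha_lim X u x \<in> closed_orbits X u"
proof -
  have "closed_orbits X u \<subseteq> K"
  proof
    fix C assume C: "C \<in> closed_orbits X u"
    then obtain c where c: "c \<in> Sing X u \<union> Per X u" "C = orbit_of u c"
      by (auto simp: closed_orbits_def)
    then obtain D where D: "c \<in> D" "D \<in> K"
      using closed_orbit_subset_nonwandering assms(3) by blast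
    have "c \<in> C" using c orbit_self Cl_iff by blast
    then have "C = D" using D disjoint_closed_orbits[of C D] C assms(2) by (auto simp: disjnt_iff)
    then show "C \<in> K" using D by simp
  qed
  then show "finite (closed_orbits X u)" using assms(1) finite_subset by blast
  assume x: "x \<in> topspace X"
  show "omega_lim X u x \<in> closed_orbits X u"
    using omega_lim_in_closed_orbits[OF x assms(1,2)] omega_lim_subset_nonwandering[OF x] assms by auto
  interpret r: compact_flow X "\<lambda>t. u (- t)" by (rule reverse_compact)
  show "alpha_lim X u x \<in> closed_orbits X u"
    using r.omega_lim_in_closed_orbits[OF x assms(1)] r.omega_lim_subset_nonwandering[OF x] assms
    by (auto simp: closed_orbits_reverse nonwandering_reverse alpha_lim_reverse)
qed

end

section \<open>Orbit equivalence and conjugacy\<close>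

text \<open>The reparametrization may vary from point to point, without continuity in
  \<open>x\<close> and without \<open>\<theta> 0 = 0\<close>. Two spaces are allowed so that
  conjugacies with the mapping torus are covered as well.\<close>

locale orbit_equivalence =
  fixes X :: "'a topology" and u :: "real \<Rightarrow> 'a \<Rightarrow> 'a"
    and Y :: "'b topology" and w :: "real \<Rightarrow> 'b \<Rightarrow> 'b" and h :: "'a \<Rightarrow> 'b"
  assumes homeo: "homeomorphic_map X Y h"
    and invariant: "x \<in> topspace X \<Longrightarrow> u t x \<in> topspace X"
    and reparametrization:
      "x \<in> topspace X \<Longrightarrow> \<exists>\<theta>. strict_mono \<theta> \<and> surj \<theta> \<and> (\<forall>t. h (u t x) = w (\<theta> t) (h x))"
begin

lemma inj: "inj_on h (topspace X)"
  using homeo by (simp add: homeomorphic_eq_everything_map)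

lemma image_topspace: "h ` topspace X = topspace Y"
  using homeo by (simp add: homeomorphic_imp_surjective_map)

lemma in_topspace: "x \<in> topspace X \<Longrightarrow> h x \<in> topspace Y"
  using image_topspace by blast

lemma orbit_image:
  assumes "x \<in> topspace X"
  shows "orbit_of w (h x) = h ` orbit_of u x"
proof -
  obtain \<theta> where \<theta>: "surj \<theta>" "\<And>t. h (u t x) = w (\<theta> t) (h x)"
    using reparametrization[OF assms] by blast
  have "range (\<lambda>t. h (u t x)) = (\<lambda>s. w s (h x)) ` range \<theta>"
    by (simp only: \<theta>(2) image_image)
  then show ?thesis using \<theta>(1) by (simp add: orbit_of_def image_image)
qed

text \<open>An increasing bijection \<open>\<theta>\<close> maps rays onto rays, so the intersection
  over \<open>n\<close> can be reindexed along \<open>\<theta>\<close>. The homeomorphism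
  \<open>h\<close> commutes with closures and, being injective, with the intersection.\<close>

lemma limits_image:
  assumes "x \<in> topspace X"
  shows omega_lim_image: "omega_lim Y w (h x) = h ` omega_lim X u x"
    and alpha_lim_image: "alpha_lim Y w (h x) = h ` alpha_lim X u x"
proof -
  obtain \<theta> where \<theta>: "strict_mono \<theta>" "surj \<theta>" "\<And>t. h (u t x) = w (\<theta> t) (h x)"
    using reparametrization[OF assms] by blast
  have less: "\<theta> s < \<theta> t \<longleftrightarrow> s < t" for s t using \<theta>(1) by (simp add: strict_mono_less)
  have ray: "\<theta> ` {n<..} = {\<theta> n<..}" "\<theta> ` {..<n} = {..<\<theta> n}" for n
  proof -
    have "s \<in> \<theta> ` {n<..}" if "s > \<theta> n" for s
      using that less surjD[OF \<theta>(2), of s] by auto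
    moreover have "s \<in> \<theta> ` {..<n}" if "s < \<theta> n" for s
      using that less surjD[OF \<theta>(2), of s] by auto
    ultimately show "\<theta> ` {n<..} = {\<theta> n<..}" "\<theta> ` {..<n} = {..<\<theta> n}"
      using less by auto
  qed
  have cl: "Y closure_of ((\<lambda>t. w t (h x)) ` \<theta> ` A) = h ` (X closure_of ((\<lambda>t. u t x) ` A))" for A
  proof -
    have "(\<lambda>t. w t (h x)) ` \<theta> ` A = h ` (\<lambda>t. u t x) ` A"
      by (simp only: image_image \<theta>(3))
    then show ?thesis
      using homeomorphic_map_closure_of[OF homeo] invariant[OF assms] by (simp add: image_subset_iff)
  qed
  have inter: "(\<Inter>n. h ` (X closure_of A n)) = h ` (\<Inter>n. X closure_of A n)" for A :: "real \<Rightarrow> _"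
    by (intro image_INT[OF inj, symmetric] ballI closure_of_subset_topspace) auto
  have "omega_lim Y w (h x) = (\<Inter>m\<in>range \<theta>. Y closure_of ((\<lambda>t. w t (h x)) ` {m<..}))"
    using \<theta>(2) by (simp add: omega_lim_def)
  also have "\<dots> = (\<Inter>n. Y closure_of ((\<lambda>t. w t (h x)) ` \<theta> ` {n<..}))"
    by (simp add: ray)
  also have "\<dots> = h ` omega_lim X u x"
    unfolding cl inter omega_lim_def ..
  finally show "omega_lim Y w (h x) = h ` omega_lim X u x" .
  have "alpha_lim Y w (h x) = (\<Inter>m\<in>range \<theta>. Y closure_of ((\<lambda>t. w t (h x)) ` {..<m}))"
    using \<theta>(2) by (simp add: alpha_lim_def)
  also have "\<dots> = (\<Inter>n. Y closure_of ((\<lambda>t. w t (h x)) ` \<theta> ` {..<n}))"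
    by (simp add: ray)
  also have "\<dots> = h ` alpha_lim X u x"
    unfolding cl inter alpha_lim_def ..
  finally show "alpha_lim Y w (h x) = h ` alpha_lim X u x" .
qed

lemma closed_orbits_image:
  assumes "flow_on X u" "flow_on Y w"
  shows "closed_orbits Y w = (`) h ` closed_orbits X u"
proof -
  interpret u: topological_flow X u by (rule topological_flow.intro) fact
  interpret w: topological_flow Y w by (rule topological_flow.intro) fact
  have Cl: "h x \<in> Sing Y w \<union> Per Y w \<longleftrightarrow> x \<in> Sing X u \<union> Per X u" if x: "x \<in> topspace X" for x
  proof -
    obtain \<theta> where \<theta>: "strict_mono \<theta>" "surj \<theta>" "\<And>t. h (u t x) = w (\<theta> t) (h x)"
      using reparametrization[OF x] by blast
    have hx: "h x \<in> topspace Y" using x by (rule in_topspace)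
    \<comment> \<open>As \<open>\<theta> 0\<close> may be nonzero, it is itself a return time of
      \<open>h x\<close>; a return time \<open>t\<close> of \<open>x\<close> therefore corresponds
      to the difference \<open>\<theta> t - \<theta> 0\<close>.\<close>
    have start: "w (\<theta> 0) (h x) = h x" using \<theta>(3)[of 0] x by simp
    have shift: "w (\<theta> 0 + s) (h x) = w s (h x)" for s
      using w.flow_add[OF hx, of s "\<theta> 0"] start by (simp add: add.commute)
    have return: "w (\<theta> t - \<theta> 0) (h x) = h x \<longleftrightarrow> u t x = x" for t
      using shift[of "\<theta> t - \<theta> 0"] \<theta>(3)[of t] inj_onD[OF inj, of "u t x" x] x by auto
    have "(\<exists>T>0. w T (h x) = h x) \<longleftrightarrow> (\<exists>T>0. u T x = x)"
    proof
      assume "\<exists>T>0. w T (h x) = h x"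
      then obtain T where T: "T > 0" "w T (h x) = h x" by blast
      obtain t where t: "\<theta> t = \<theta> 0 + T" using \<theta>(2) by (metis surjD)
      then have "t > 0" using T \<theta>(1) by (metis less_add_same_cancel1 strict_mono_less)
      then show "\<exists>T>0. u T x = x" using return[of t] t T by auto
    next
      assume "\<exists>T>0. u T x = x"
      then obtain T where "T > 0" "u T x = x" by blast
      then show "\<exists>T>0. w T (h x) = h x"
        using return[of T] \<theta>(1) by (intro exI[of _ "\<theta> T - \<theta> 0"]) (auto simp: strict_mono_less)
    qed
    then show ?thesis using u.Cl_iff w.Cl_iff x hx by blast
  qed
  have "Sing Y w \<union> Per Y w = h ` (Sing X u \<union> Per X u)"
  proof (intro set_eqI iffI)
    fix y assume y: "y \<in> Sing Y w \<union> Per Y w"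
    then have "y \<in> h ` topspace X" using w.Cl_iff image_topspace by metis
    then show "y \<in> h ` (Sing X u \<union> Per X u)" using Cl y by (metis imageE imageI)
  next
    fix y assume "y \<in> h ` (Sing X u \<union> Per X u)"
    then obtain x where "x \<in> Sing X u \<union> Per X u" "y = h x" by (rule imageE)
    then show "y \<in> Sing Y w \<union> Per Y w" using Cl u.Cl_iff by metis
  qed
  then have "closed_orbits Y w = (\<lambda>x. orbit_of w (h x)) ` (Sing X u \<union> Per X u)"
    by (simp only: closed_orbits_def image_image)
  also have "\<dots> = (\<lambda>x. h ` orbit_of u x) ` (Sing X u \<union> Per X u)"
    using orbit_image u.Cl_iff by (intro image_cong) auto
  finally show ?thesis by (simp only: closed_orbits_def image_image)
qed

end

text \<open>Used with \<open>untwist\<close> as \<open>h\<close>, from the suspension flow to the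
  product with a rotation.\<close>

locale flow_conjugacy =
  fixes X :: "'a topology" and u :: "real \<Rightarrow> 'a \<Rightarrow> 'a"
    and Y :: "'b topology" and w :: "real \<Rightarrow> 'b \<Rightarrow> 'b" and h :: "'a \<Rightarrow> 'b"
  assumes homeo: "homeomorphic_map X Y h"
    and invariant: "x \<in> topspace X \<Longrightarrow> u t x \<in> topspace X"
    and conjugate: "x \<in> topspace X \<Longrightarrow> h (u t x) = w t (h x)"

sublocale flow_conjugacy \<subseteq> orbit_equivalence
  by unfold_locales (use homeo invariant conjugate strict_mono_id in \<open>auto intro!: exI[of _ id]\<close>)

context flow_conjugacy
begin

lemma mem_image: "x \<in> topspace X \<Longrightarrow> A \<subseteq> topspace X \<Longrightarrow> h x \<in> h ` A \<longleftrightarrow> x \<in> A"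
  by (rule inj_on_image_mem_iff[OF inj])

lemma image_eq: "A \<subseteq> topspace X \<Longrightarrow> B \<subseteq> topspace X \<Longrightarrow> h ` A = h ` B \<longleftrightarrow> A = B"
  by (rule inj_on_image_eq_iff[OF inj])

lemma fixed_iff: "x \<in> topspace X \<Longrightarrow> w t (h x) = h x \<longleftrightarrow> u t x = x"
  using conjugate invariant inj by (metis inj_onD)

lemma Sing_iff: "x \<in> topspace X \<Longrightarrow> h x \<in> Sing Y w \<longleftrightarrow> x \<in> Sing X u"
  by (simp add: Sing_def in_topspace fixed_iff)

lemma Per_iff: "x \<in> topspace X \<Longrightarrow> h x \<in> Per Y w \<longleftrightarrow> x \<in> Per X u"
  by (simp add: Per_def in_topspace fixed_iff Sing_iff)

lemma recurrent_iff: "x \<in> topspace X \<Longrightarrow> h x \<in> recurrent Y w \<longleftrightarrow> x \<in> recurrent X u"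
  by (simp add: recurrent_def in_topspace limits_image mem_image
      omega_lim_subset_topspace alpha_lim_subset_topspace)

lemma P_set_iff: "x \<in> topspace X \<Longrightarrow> h x \<in> P_set Y w \<longleftrightarrow> x \<in> P_set X u"
  by (simp add: P_set_def in_topspace recurrent_iff)

lemma R_set_iff: "x \<in> topspace X \<Longrightarrow> h x \<in> R_set Y w \<longleftrightarrow> x \<in> R_set X u"
  by (simp add: R_set_def recurrent_iff Sing_iff Per_iff)

lemma stratum_iff:
  "x \<in> topspace X \<Longrightarrow> y \<in> topspace X \<Longrightarrow> h y \<in> stratum Y w (h x) \<longleftrightarrow> y \<in> stratum X u x"
  by (simp add: stratum_def Sing_iff Per_iff P_set_iff R_set_iff)

lemma orbit_subset: "x \<in> topspace X \<Longrightarrow> orbit_of u x \<subseteq> topspace X"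
  using invariant by (auto simp: orbit_of_def)

lemma limits'_image:
  assumes "x \<in> topspace X"
  shows "omega_lim' Y w (h x) = h ` omega_lim' X u x"
    and "alpha_lim' Y w (h x) = h ` alpha_lim' X u x"
  using inj_on_image_set_diff[OF inj, of _ "orbit_of u x"] assms orbit_subset[OF assms]
    omega_lim_subset_topspace[of X u x] alpha_lim_subset_topspace[of X u x]
  by (auto simp: omega_lim'_def alpha_lim'_def limits_image orbit_image)

text \<open>Limit sets, orbit closures and strata correspond under \<open>h\<close>. Hence so do the
  sets in which components are taken, and \<open>h\<close> restricts to a homeomorphism of
  \<open>A\<close> onto its image, which preserves components.\<close>

lemma weak_orbit_iff:
  assumes x: "x \<in> topspace X" and y: "y \<in> topspace X"
  shows "h y \<in> weak_orbit Y w (h x) \<longleftrightarrow> y \<in> weak_orbit X u x"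
proof -
  have "X closure_of orbit_of u z \<subseteq> topspace X" for z
    by (rule closure_of_subset_topspace)
  then have closures: "Y closure_of orbit_of w (h y) = Y closure_of orbit_of w (h x) \<longleftrightarrow>
      X closure_of orbit_of u y = X closure_of orbit_of u x"
    using homeomorphic_map_closure_of[OF homeo] orbit_subset x y
    by (simp add: orbit_image image_eq)
  have limits: "alpha_lim Y w (h y) = alpha_lim Y w (h x) \<longleftrightarrow> alpha_lim X u y = alpha_lim X u x"
    "omega_lim Y w (h y) = omega_lim Y w (h x) \<longleftrightarrow> omega_lim X u y = omega_lim X u x"
    unfolding limits_image[OF x] limits_image[OF y]
    by (intro image_eq omega_lim_subset_topspace alpha_lim_subset_topspace)+
  have limits': "alpha_lim' Y w (h z) = alpha_lim' Y w (h x) \<longleftrightarrow> alpha_lim' X u z = alpha_lim' X u x"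
    "omega_lim' Y w (h z) = omega_lim' Y w (h x) \<longleftrightarrow> omega_lim' X u z = omega_lim' X u x"
    if z: "z \<in> topspace X" for z
  proof -
    have "omega_lim' X u z \<subseteq> topspace X" "alpha_lim' X u z \<subseteq> topspace X" for z
      using omega_lim_subset_topspace[of X u z] alpha_lim_subset_topspace[of X u z]
      by (auto simp: omega_lim'_def alpha_lim'_def)
    then show "alpha_lim' Y w (h z) = alpha_lim' Y w (h x) \<longleftrightarrow> alpha_lim' X u z = alpha_lim' X u x"
      "omega_lim' Y w (h z) = omega_lim' Y w (h x) \<longleftrightarrow> omega_lim' X u z = omega_lim' X u x"
      using x z by (simp_all add: limits'_image image_eq)
  qed
  define A where "A = {z \<in> topspace X. alpha_lim' X u z = alpha_lim' X u x \<and>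
      omega_lim' X u z = omega_lim' X u x} \<inter> stratum X u x"
  have AX: "A \<subseteq> topspace X" by (auto simp: A_def)
  have A: "{z \<in> topspace Y. alpha_lim' Y w z = alpha_lim' Y w (h x) \<and>
      omega_lim' Y w z = omega_lim' Y w (h x)} \<inter> stratum Y w (h x) = h ` A" (is "?B = _")
  proof (intro set_eqI iffI)
    have iff: "h z \<in> ?B \<longleftrightarrow> z \<in> A" if "z \<in> topspace X" for z
      using that limits' stratum_iff[OF x that] in_topspace by (simp add: A_def)
    show "y \<in> h ` A" if "y \<in> ?B" for y
    proof -
      have "y \<in> h ` topspace X" using that image_topspace by simp
      then obtain z where "y = h z" "z \<in> topspace X" by (rule imageE)
      then show ?thesis using iff[of z] that by blast
    qed
    show "y \<in> ?B" if "y \<in> h ` A" for y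
    proof -
      from that obtain z where "y = h z" "z \<in> A" by (rule imageE)
      then show ?thesis using iff[of z] AX by blast
    qed
  qed
  have xA: "x \<in> topspace (subtopology X A)"
    using x by (simp add: A_def stratum_def R_set_def P_set_def)
  have "homeomorphic_map (subtopology X A) (subtopology Y (h ` A)) h"
  proof (rule homeomorphic_map_subtopologies[OF homeo])
    have "h ` A \<subseteq> topspace Y" using AX image_topspace by (metis image_mono)
    then show "h ` (topspace X \<inter> A) = topspace Y \<inter> h ` A" using AX by (simp add: Int_absorb1)
  qed
  from homeomorphic_map_connected_component_of[OF this xA]
  have weak2: "weak_orbit2 Y w (h x) = h ` weak_orbit2 X u x"
    unfolding weak_orbit2_eq A by (simp add: A_def)
  have weak2X: "weak_orbit2 X u x \<subseteq> topspace X"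
    unfolding weak_orbit2_eq using connected_component_of_subset_topspace by fastforce
  show ?thesis
  proof (cases "x \<in> R_set X u")
    case True
    then show ?thesis
      using x y closures limits in_topspace by (simp add: weak_orbit_def R_set_iff)
  next
    case False
    then show ?thesis
      using x y weak2X by (simp add: weak_orbit_def R_set_iff weak2 mem_image)
  qed
qed

end

lemma quotient_space_cong:
  assumes "\<And>x. x \<in> topspace X \<Longrightarrow> c x = d x"
  shows "quotient_space X c = quotient_space X d"
proof -
  have "c ` topspace X = d ` topspace X"
    "{x \<in> topspace X. c x \<in> U} = {x \<in> topspace X. d x \<in> U}" for U
    using assms by auto
  then show ?thesis by (simp add: quotient_space_def)
qed

lemma quotient_map_quotient_space: "quotient_map X (quotient_space X c) c"
  by (simp add: quotient_map_def openin_quotient_space)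

section \<open>The product of a flow with a rotation\<close>

abbreviation circle :: "complex topology" where
  "circle \<equiv> top_of_set (sphere 0 1)"

text \<open>The speed \<open>c\<close> is kept general because reversing time replaces it by
  \<open>- c\<close>.\<close>

definition rotated_flow ::
  "real \<Rightarrow> (real \<Rightarrow> 'a \<Rightarrow> 'a) \<Rightarrow> real \<Rightarrow> 'a \<times> complex \<Rightarrow> 'a \<times> complex" where
  "rotated_flow c v t p = (v t (fst p), cis (c * t) * snd p)"

lemma rotated_flow_reverse:
  "(\<lambda>t. rotated_flow c v (- t)) = rotated_flow (- c) (\<lambda>t. v (- t))"
  by (auto simp: rotated_flow_def fun_eq_iff)

context topological_flow
begin

lemma rotated: "topological_flow (prod_topology X circle) (rotated_flow c u)"
proof
  let ?Z = "prod_topology X circle"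
  have 1: "continuous_map (prod_topology euclideanreal ?Z) (prod_topology euclideanreal X)
      (\<lambda>p. (fst p, fst (snd p)))"
    by (intro continuous_map_pairedI continuous_map_fst
        continuous_map_compose[OF continuous_map_snd continuous_map_fst, unfolded o_def])
  from continuous_map_compose[OF 1 continuous_map_flow]
  have 2: "continuous_map (prod_topology euclideanreal ?Z) X (\<lambda>p. u (fst p) (fst (snd p)))"
    by (simp add: o_def)
  have 3: "continuous_map (prod_topology euclideanreal ?Z) (prod_topology euclideanreal circle)
      (\<lambda>p. (fst p, snd (snd p)))"
    by (intro continuous_map_pairedI continuous_map_fst
        continuous_map_compose[OF continuous_map_snd continuous_map_snd, unfolded o_def])
  have "continuous_on (UNIV \<times> sphere 0 1) (\<lambda>p. cis (c * fst p) * snd p)"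
    by (intro continuous_intros)
  then have "continuous_map (prod_topology euclideanreal circle) circle (\<lambda>p. cis (c * fst p) * snd p)"
    by (subst subtopology_UNIV[symmetric], subst prod_topology_subtopology_eu)
       (auto simp: continuous_map_in_subtopology norm_mult)
  from continuous_map_compose[OF 3 this]
  have 4: "continuous_map (prod_topology euclideanreal ?Z) circle (\<lambda>p. cis (c * fst p) * snd (snd p))"
    by (simp add: o_def)
  from continuous_map_pairedI[OF 2 4]
  have "continuous_map (prod_topology euclideanreal ?Z) ?Z (\<lambda>(t, x). rotated_flow c u t x)"
    by (simp add: rotated_flow_def case_prod_unfold)
  then show "flow_on ?Z (rotated_flow c u)"
    by (auto simp: flow_on_def rotated_flow_def flow_add distrib_left simp flip: cis_mult mult.assoc)
qed

end

lemma circle_transitive: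
  assumes "cmod z = 1" "cmod z' = 1"
  obtains b where "cis b * z = z'"
proof
  have "z \<noteq> 0" "z' \<noteq> 0" using assms by auto
  then show "cis (Arg (z' / z)) * z = z'"
    using assms cis_Arg[of "z' / z"] by (simp add: sgn_eq norm_divide)
qed

lemma cis_shift: "cis (a - 2 * pi * of_int m) = cis a"
  using cis_multiple_2pi[of m] by (simp add: cis_divide[symmetric])

text \<open>Kronecker's theorem provides a positive multiplier; aiming at \<open>b - N * a\<close>
  and then adding \<open>N\<close> pushes the multiplier beyond \<open>N\<close>.\<close>

lemma irrational_multiples_dense:
  fixes a :: real
  assumes "a \<notin> \<rat>" "e > 0"
  shows "\<exists>k m. k > N \<and> \<bar>of_int k * a - of_int m - b\<bar> < e"
proof -
  obtain m k where "k > 0" "\<bar>of_int k * a - of_int m - (b - of_int N * a)\<bar> < e"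
    using sequence_of_fractional_parts_is_dense[OF assms] by metis
  then show ?thesis by (intro exI[of _ "k + N"] exI[of _ m]) (simp add: algebra_simps)
qed

section \<open>Limit sets and periodic points of the product\<close>

context compact_flow
begin

abbreviation Z :: "('a \<times> complex) topology" where
  "Z \<equiv> prod_topology X circle"

lemma rotated_compact: "compact_flow Z (rotated_flow c u)"
proof -
  have "compact_space circle"
    by (simp add: compact_space_subtopology compactin_euclidean_iff)
  then show ?thesis
    using rotated compact Hausdorff
    by (simp add: compact_flow.intro compact_flow_axioms.intro compact_space_prod_topology
        Hausdorff_space_prod_topology Hausdorff_space_subtopology)
qed

lemma omega_lim_rotated_subset:
  "omega_lim Z (rotated_flow c u) (x, \<zeta>) \<subseteq> omega_lim X u x \<times> sphere 0 1"
proof (rule subsetI)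
  fix p assume "p \<in> omega_lim Z (rotated_flow c u) (x, \<zeta>)"
  then have p: "p \<in> topspace Z"
    "\<And>V n. openin Z V \<Longrightarrow> p \<in> V \<Longrightarrow> \<exists>t>n. rotated_flow c u t (x, \<zeta>) \<in> V"
    unfolding in_omega_lim_iff by auto
  have "\<exists>t>n. u t x \<in> U" if "openin X U" "fst p \<in> U" for U n
    using p(2)[of "U \<times> sphere 0 1" n] p(1) that
    by (auto simp: openin_prod_Times_iff mem_Times_iff rotated_flow_def)
  then show "p \<in> omega_lim X u x \<times> sphere 0 1"
    using p(1) by (auto simp: in_omega_lim_iff mem_Times_iff)
qed

lemma orbit_rotated_subset:
  "cmod \<zeta> = 1 \<Longrightarrow> orbit_of (rotated_flow c u) (x, \<zeta>) \<subseteq> orbit_of u x \<times> sphere 0 1"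
  by (auto simp: orbit_of_def rotated_flow_def norm_mult)

text \<open>It suffices to test boxes, but one \<open>t\<close> must serve both coordinates; this is
  where the product differs from its factors.\<close>

lemma in_omega_lim_rotatedI:
  assumes "y \<in> topspace X" "cmod z = 1"
    and "\<And>U V n. openin X U \<Longrightarrow> y \<in> U \<Longrightarrow> openin circle V \<Longrightarrow> z \<in> V \<Longrightarrow>
           \<exists>t>n. u t x \<in> U \<and> cis (c * t) * \<zeta> \<in> V"
  shows "(y, z) \<in> omega_lim Z (rotated_flow c u) (x, \<zeta>)"
  unfolding in_omega_lim_iff
proof (intro conjI allI impI)
  show "(y, z) \<in> topspace Z" using assms by simp
  fix O' n assume "openin Z O'" "(y, z) \<in> O'"
  then obtain U V where UV: "openin X U" "openin circle V" "y \<in> U" "z \<in> V" "U \<times> V \<subseteq> O'"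
    unfolding openin_prod_topology_alt by metis
  then obtain t where "t > n" "u t x \<in> U" "cis (c * t) * \<zeta> \<in> V" using assms(3) by metis
  then show "\<exists>t>n. rotated_flow c u t (x, \<zeta>) \<in> O'"
    using UV by (intro exI[of _ t]) (auto simp: rotated_flow_def)
qed

text \<open>All late times bring the first coordinate near \<open>p\<close>, so among them one can
  be picked at which the second coordinate is exactly \<open>z\<close>.\<close>

lemma omega_lim_rotated_singular:
  assumes x: "x \<in> topspace X" and p: "omega_lim X u x = {p}" and c: "c \<noteq> 0" and \<zeta>: "cmod \<zeta> = 1"
  shows "omega_lim Z (rotated_flow c u) (x, \<zeta>) = {p} \<times> sphere 0 1"
proof
  show "omega_lim Z (rotated_flow c u) (x, \<zeta>) \<subseteq> {p} \<times> sphere 0 1"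
    using omega_lim_rotated_subset p by metis
  have "(p, z) \<in> omega_lim Z (rotated_flow c u) (x, \<zeta>)" if z: "cmod z = 1" for z
  proof (rule in_omega_lim_rotatedI[OF _ z])
    show "p \<in> topspace X" using p omega_lim_subset_topspace[of X u x] by simp
    fix U V n assume "openin X U" "p \<in> U" "openin circle V" "z \<in> V"
    then obtain T where T: "\<And>t. t > T \<Longrightarrow> u t x \<in> U"
      using omega_lim_attracts[OF x, of U] p by auto
    obtain b where b: "cis b * \<zeta> = z" using circle_transitive[OF \<zeta> z] .
    \<comment> \<open>\<open>r\<close> is the period of the rotation. The times
      \<open>b / c + k * r\<close> are those at which the angle \<open>c * t\<close> equals
      \<open>b\<close> modulo \<open>2 * pi\<close>; \<open>k\<close> is taken large enough to pass
      both \<open>n\<close> and \<open>T\<close>.\<close>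
    define r where "r = \<bar>2 * pi / c\<bar>"
    have "r > 0" using c by (simp add: r_def)
    then obtain k :: nat where k: "max n T - b / c < of_nat k * r"
      using reals_Archimedean3 by blast
    define t where "t = b / c + of_nat k * r"
    have "c * t = b - 2 * pi * of_int (if c > 0 then - int k else int k)"
      using c by (auto simp: t_def r_def abs_if field_simps zero_less_divide_iff)
    then have "cis (c * t) * \<zeta> = z" using b cis_shift by metis
    moreover have "t > n" "t > T" using k by (auto simp: t_def)
    ultimately show "\<exists>t>n. u t x \<in> U \<and> cis (c * t) * \<zeta> \<in> V" using T \<open>z \<in> V\<close> by auto
  qed
  then show "{p} \<times> sphere 0 1 \<subseteq> omega_lim Z (rotated_flow c u) (x, \<zeta>)" by auto
qed

lemma rotated_fixed_iff:
  "cmod \<zeta> = 1 \<Longrightarrow>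
     rotated_flow c u t (x, \<zeta>) = (x, \<zeta>) \<longleftrightarrow> u t x = x \<and> cis (c * t) = 1"
  by (auto simp: rotated_flow_def)

text \<open>At time \<open>pi / c\<close> the circle has made a half turn, which moves every
  point.\<close>

lemma Sing_rotated:
  assumes "c \<noteq> 0"
  shows "Sing Z (rotated_flow c u) = {}"
proof -
  have "cis (c * (pi / c)) \<noteq> 1" using assms by (simp add: cis_pi)
  then have "rotated_flow c u (pi / c) (x, \<zeta>) \<noteq> (x, \<zeta>)" if "cmod \<zeta> = 1" for x \<zeta>
    using that rotated_fixed_iff by blast
  then show ?thesis unfolding Sing_def by fastforce
qed

lemma Per_rotated_iff:
  assumes "c \<noteq> 0" "cmod \<zeta> = 1"
  shows "(x, \<zeta>) \<in> Per Z (rotated_flow c u) \<longleftrightarrow>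
     x \<in> topspace X \<and> (\<exists>T>0. u T x = x \<and> cis (c * T) = 1)"
  using assms by (simp add: Per_def Sing_rotated rotated_fixed_iff)

text \<open>A common return time of \<open>x\<close> and the rotation serves all points of the orbit
  of \<open>x\<close> and all phases.\<close>

lemma Per_rotated_orbit:
  assumes c: "c \<noteq> 0" and p: "(x, \<zeta>) \<in> Per Z (rotated_flow c u)"
  shows "orbit_of u x \<times> sphere 0 1 \<subseteq> Per Z (rotated_flow c u)"
proof -
  have "cmod \<zeta> = 1" using p by (auto simp: Per_def)
  then obtain T where T: "x \<in> topspace X" "T > 0" "u T x = x" "cis (c * T) = 1"
    using p Per_rotated_iff[OF c] by blast
  have "(y, z) \<in> Per Z (rotated_flow c u)" if "y \<in> orbit_of u x" "cmod z = 1" for y z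
    using that T return_orbit[OF T(1,3)] orbit_subset_topspace[OF T(1)] Per_rotated_iff[OF c that(2), of y]
    by blast
  then show ?thesis by auto
qed

lemma Per_rotated_subset:
  assumes "c \<noteq> 0"
  shows "Per Z (rotated_flow c u) \<subseteq> (Sing X u \<union> Per X u) \<times> sphere 0 1"
proof (rule subsetI)
  fix p assume p: "p \<in> Per Z (rotated_flow c u)"
  then have "cmod (snd p) = 1" by (auto simp: Per_def)
  with p show "p \<in> (Sing X u \<union> Per X u) \<times> sphere 0 1"
    using Per_rotated_iff[OF assms, of "snd p" "fst p"] Cl_iff by (auto simp: mem_Times_iff)
qed

text \<open>At the times \<open>s + k * T\<close> the first coordinate is exactly
  \<open>u s x\<close>, while the phases at these times are dense in the circle.\<close>

lemma omega_lim_rotated_irrational: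
  assumes x: "x \<in> Sing X u \<union> Per X u" and c: "c \<noteq> 0" and \<zeta>: "cmod \<zeta> = 1"
    and notPer: "(x, \<zeta>) \<notin> Per Z (rotated_flow c u)"
  shows "omega_lim Z (rotated_flow c u) (x, \<zeta>) = orbit_of u x \<times> sphere 0 1"
proof
  show "omega_lim Z (rotated_flow c u) (x, \<zeta>) \<subseteq> orbit_of u x \<times> sphere 0 1"
    using omega_lim_rotated_subset omega_lim_closed_orbit[OF Hausdorff x] by metis
  obtain T where T: "T > 0" "u T x = x" and xX: "x \<in> topspace X" using x Cl_iff by blast
  \<comment> \<open>\<open>a\<close> is the number of turns of the circle during the return time
    \<open>T\<close>, which need not be the least one. If \<open>a = m / n\<close>, then
    \<open>n * T\<close> would be a common return time, contradicting \<open>notPer\<close>.\<close>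
  define a where "a = c * T / (2 * pi)"
  have irr: "a \<notin> \<rat>"
  proof
    assume "a \<in> \<rat>"
    then obtain m :: int and n :: nat where mn: "a = of_int m / of_nat n" "n > 0"
      by (metis Rats_cases' of_int_of_nat_eq zero_less_imp_eq_int)
    have "u (of_int (int n) * T) x = x" by (rule return_multiple[OF xX T(2)])
    moreover have "c * (of_int (int n) * T) = 2 * pi * of_int m"
      using mn by (simp add: a_def field_simps)
    then have "cis (c * (of_int (int n) * T)) = 1" by (simp add: cis_multiple_2pi)
    moreover have "of_int (int n) * T > 0" using mn T by simp
    ultimately show False using notPer Per_rotated_iff[OF c \<zeta>] xX by blast
  qed
  have "(u s x, z) \<in> omega_lim Z (rotated_flow c u) (x, \<zeta>)" if z: "cmod z = 1" for s z
  proof (rule in_omega_lim_rotatedI[OF _ z])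
    show "u s x \<in> topspace X" using xX by simp
    fix U V n assume U: "openin X U" "u s x \<in> U" and V: "openin circle V" "z \<in> V"
    obtain b where b: "cis b * \<zeta> = z" using circle_transitive[OF \<zeta> z] .
    have "continuous_map euclideanreal circle (\<lambda>r. cis r * \<zeta>)"
      using \<zeta> by (auto simp: continuous_map_in_subtopology norm_mult intro!: continuous_intros)
    then have "open {r. cis r * \<zeta> \<in> V}"
      using openin_continuous_map_preimage[OF _ V(1)] by fastforce
    then obtain e where e: "e > 0" "\<And>r. \<bar>r - b\<bar> < e \<Longrightarrow> cis r * \<zeta> \<in> V"
      unfolding open_dist using b V(2) by (force simp: dist_real_def)
    \<comment> \<open>The angle \<open>c * (s + k * T)\<close> should be within \<open>e\<close> of
      \<open>b\<close> modulo \<open>2 * pi\<close>; dividing by \<open>2 * pi\<close> gives the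
      target and the tolerance. The bound on \<open>k\<close> ensures \<open>t > n\<close>.\<close>
    obtain k m where k: "k > \<lfloor>(n - s) / T\<rfloor>"
      and km: "\<bar>of_int k * a - of_int m - (b - c * s) / (2 * pi)\<bar> < e / (2 * pi)"
      using irrational_multiples_dense[OF irr, of "e / (2 * pi)" "\<lfloor>(n - s) / T\<rfloor>"] e(1) by fastforce
    define t where "t = s + of_int k * T"
    have "(n - s) / T < of_int k" using k by linarith
    then have "t > n" using T(1) by (simp add: t_def field_simps)
    have "u t x = u s x"
      unfolding t_def flow_add[OF xX] return_multiple[OF xX T(2)] ..
    define d where "d = of_int k * a - of_int m - (b - c * s) / (2 * pi)"
    have "c * t - 2 * pi * of_int m - b = 2 * pi * d"
      by (simp add: t_def a_def d_def field_simps)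
    moreover have "\<bar>2 * pi * d\<bar> < e"
      using km unfolding d_def[symmetric] by (simp add: abs_mult field_simps)
    ultimately have near: "\<bar>c * t - 2 * pi * of_int m - b\<bar> < e" by simp
    have "cis (c * t) * \<zeta> \<in> V" using e(2)[OF near] cis_shift by metis
    with \<open>t > n\<close> \<open>u t x = u s x\<close> show "\<exists>t>n. u t x \<in> U \<and> cis (c * t) * \<zeta> \<in> V" using U by auto
  qed
  then show "orbit_of u x \<times> sphere 0 1 \<subseteq> omega_lim Z (rotated_flow c u) (x, \<zeta>)"
    by (auto simp: orbit_of_def)
qed

lemma alpha_lim_rotated_singular:
  assumes "x \<in> topspace X" "alpha_lim X u x = {p}" "c \<noteq> 0" "cmod \<zeta> = 1"
  shows "alpha_lim Z (rotated_flow c u) (x, \<zeta>) = {p} \<times> sphere 0 1"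
  using compact_flow.omega_lim_rotated_singular[OF reverse_compact, of x p "- c" \<zeta>] assms
  by (simp add: alpha_lim_reverse rotated_flow_reverse)

lemma alpha_lim_rotated_irrational:
  assumes x: "x \<in> Sing X u \<union> Per X u" and c: "c \<noteq> 0" and \<zeta>: "cmod \<zeta> = 1"
    and notPer: "(x, \<zeta>) \<notin> Per Z (rotated_flow c u)"
  shows "alpha_lim Z (rotated_flow c u) (x, \<zeta>) = orbit_of u x \<times> sphere 0 1"
proof -
  interpret Z: compact_flow Z "rotated_flow c u" by (rule rotated_compact)
  have "(x, \<zeta>) \<notin> Per Z (rotated_flow (- c) (\<lambda>t. u (- t)))"
    using notPer Z.Per_reverse unfolding rotated_flow_reverse by metis
  moreover have "x \<in> Sing X (\<lambda>t. u (- t)) \<union> Per X (\<lambda>t. u (- t))"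
    using x unfolding Cl_reverse .
  ultimately show ?thesis
    using compact_flow.omega_lim_rotated_irrational[OF reverse_compact, of x "- c" \<zeta>] c \<zeta>
    by (simp add: alpha_lim_reverse rotated_flow_reverse orbit_of_reverse)
qed

end

section \<open>Weak orbits when limit sets are closed orbits and limit cycles are absent\<close>

locale gradient_like_flow = compact_flow +
  assumes finite_closed_orbits: "finite (closed_orbits X u)"
    and omega_lim_closed: "x \<in> topspace X \<Longrightarrow> omega_lim X u x \<in> closed_orbits X u"
    and alpha_lim_closed: "x \<in> topspace X \<Longrightarrow> alpha_lim X u x \<in> closed_orbits X u"
    and no_limit_cycle: "\<not> limit_cycle X u C"
begin

abbreviation Cl :: "'a set" where
  "Cl \<equiv> Sing X u \<union> Per X u"

lemma Cl_subset: "Cl \<subseteq> topspace X"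
  using Cl_iff by blast

text \<open>A limit set \<open>C\<close> of \<open>x\<close> is a closed orbit that does not contain
  \<open>x\<close>, as all points of \<open>C\<close> are closed. If it were periodic,
  \<open>x\<close> would make it a limit cycle.\<close>

lemma limits_singular:
  assumes x: "x \<in> topspace X - Cl"
  shows "\<exists>p\<in>Sing X u. omega_lim X u x = {p}" "\<exists>p\<in>Sing X u. alpha_lim X u x = {p}"
proof -
  have *: "\<exists>p\<in>Sing X u. C = {p}"
    if C: "C \<in> closed_orbits X u" and lim: "alpha_lim X u x = C \<or> omega_lim X u x = C" for C
  proof -
    obtain p where p: "p \<in> Cl" "C = orbit_of u p" using C by (auto simp: closed_orbits_def)
    have "x \<notin> C"
    proof
      assume "x \<in> C"
      then have "x \<in> Cl" using p closed_orbit_points by blast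
      then show False using x by simp
    qed
    then have "p \<notin> Per X u" using no_limit_cycle[of C] p(2) lim x by (auto simp: limit_cycle_def)
    then show ?thesis using p Sing_orbit by blast
  qed
  show "\<exists>p\<in>Sing X u. omega_lim X u x = {p}" "\<exists>p\<in>Sing X u. alpha_lim X u x = {p}"
    using *[OF omega_lim_closed] *[OF alpha_lim_closed] x by blast+
qed

text \<open>Off \<open>Cl\<close> the limit sets are singular points different from
  \<open>x\<close>. Consequently \<open>R_set X u\<close> is empty, whereas the product can have
  points of this kind.\<close>

lemma recurrent_eq: "recurrent X u = Cl"
proof (intro set_eqI iffI)
  fix x assume x: "x \<in> recurrent X u"
  show "x \<in> Cl"
  proof (rule ccontr)
    assume "x \<notin> Cl"
    then have "x \<in> topspace X - Cl" using x by (simp add: recurrent_def)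
    from limits_singular[OF this] show False using x \<open>x \<notin> Cl\<close> by (auto simp: recurrent_def)
  qed
next
  fix x assume x: "x \<in> Cl"
  then have "x \<in> orbit_of u x" using orbit_self Cl_subset by blast
  then show "x \<in> recurrent X u"
    using x orbit_subset_omega_lim_closed_orbit[OF x] Cl_subset unfolding recurrent_def by blast
qed

lemma limits'_closed_orbit:
  assumes "x \<in> Cl"
  shows "omega_lim' X u x = {}" "alpha_lim' X u x = {}"
  using omega_lim_closed_orbit[OF Hausdorff assms] alpha_lim_closed_orbit[OF Hausdorff assms]
  by (simp_all add: omega_lim'_def alpha_lim'_def)

lemma orbit_not_closed:
  assumes "x \<in> topspace X - Cl"
  shows "orbit_of u x \<inter> Cl = {}"
proof (rule ccontr)
  assume "orbit_of u x \<inter> Cl \<noteq> {}"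
  then obtain y where y: "y \<in> orbit_of u x" "y \<in> Cl" by blast
  then have "x \<in> orbit_of u y" using orbit_eq orbit_self assms by blast
  then show False using y(2) Sing_orbit[of y] Per_orbit[of y x] assms by auto
qed

lemma limits'_not_closed:
  assumes "x \<in> topspace X - Cl"
  shows "omega_lim' X u x = omega_lim X u x" "alpha_lim' X u x = alpha_lim X u x"
  using limits_singular[OF assms] orbit_not_closed[OF assms]
  by (auto simp: omega_lim'_def alpha_lim'_def)

text \<open>By finiteness the union of the other closed orbits is closed, so each closed orbit is
  separated from all the rest.\<close>

lemma connected_subset_orbit:
  assumes S: "connectedin X S" "S \<subseteq> Cl" and x: "x \<in> S"
  shows "S \<subseteq> orbit_of u x"
proof -
  let ?C = "orbit_of u x" and ?D = "\<Union>(closed_orbits X u - {orbit_of u x})"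
  have C: "?C \<in> closed_orbits X u" using S x by (auto simp: closed_orbits_def)
  have "closedin X ?C" "closedin X ?D"
    using C finite_closed_orbits closedin_closed_orbit by (auto intro!: closedin_Union)
  moreover have "S \<subseteq> ?C \<union> ?D"
    using S(2) orbit_self Cl_subset by (fastforce simp: closed_orbits_def)
  moreover have disj: "?C \<inter> ?D = {}"
    using disjoint_closed_orbits[OF C] by (auto simp: disjnt_iff)
  moreover have "?C \<inter> S \<noteq> {}"
    using x S orbit_self Cl_subset by blast
  ultimately have "?D \<inter> S = {}"
    using S(1) unfolding connectedin_closedin by (metis Int_empty_left)
  then show ?thesis using \<open>S \<subseteq> ?C \<union> ?D\<close> by blast
qed

text \<open>On \<open>Cl\<close> the primed limit sets are empty, so the condition on limits is void
  and the class is the component of \<open>x\<close> in its stratum.\<close>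

lemma weak_orbit_closed:
  assumes x: "x \<in> Cl"
  shows "weak_orbit X u x = orbit_of u x"
proof -
  have xX: "x \<in> topspace X" using x Cl_subset by blast
  define B where "B = stratum X u x"
  have B: "B \<subseteq> Cl" "orbit_of u x \<subseteq> B"
    using x Sing_orbit Per_orbit by (auto simp: B_def stratum_def)
  have "{y \<in> topspace X. alpha_lim' X u y = alpha_lim' X u x \<and>
      omega_lim' X u y = omega_lim' X u x} \<inter> B = B"
    using B(1) Cl_subset limits'_closed_orbit x by auto
  then have "weak_orbit X u x = connected_component_of_set (subtopology X B) x"
    using x by (simp add: weak_orbit_def weak_orbit2_eq R_set_def flip: B_def)
  also have "\<dots> = orbit_of u x"
  proof (rule connected_component_of_unique)
    show "x \<in> orbit_of u x" using orbit_self[OF xX] .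
    show "connectedin (subtopology X B) (orbit_of u x)"
      using connectedin_orbit[OF xX] B by (simp add: connectedin_subtopology)
    show "C \<subseteq> orbit_of u x" if "x \<in> C \<and> connectedin (subtopology X B) C" for C
      using that connected_subset_orbit[of C x] B by (auto simp: connectedin_subtopology)
  qed
  finally show ?thesis .
qed

text \<open>Off \<open>Cl\<close> removing the orbit from the limit sets removes nothing, and the
  stratum is the complement of \<open>Cl\<close> because only closed points are recurrent.\<close>

lemma weak_orbit_not_closed:
  assumes x: "x \<in> topspace X - Cl"
  shows "weak_orbit X u x = connected_component_of_set
    (subtopology X {y \<in> topspace X - Cl. alpha_lim X u y = alpha_lim X u x \<and>
                                       omega_lim X u y = omega_lim X u x}) x"
proof -
  have "stratum X u x = topspace X - Cl"
    using x by (auto simp: stratum_def P_set_def recurrent_eq)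
  then have "{y \<in> topspace X. alpha_lim' X u y = alpha_lim' X u x \<and>
      omega_lim' X u y = omega_lim' X u x} \<inter> stratum X u x =
    {y \<in> topspace X - Cl. alpha_lim X u y = alpha_lim X u x \<and> omega_lim X u y = omega_lim X u x}"
    using limits'_not_closed x by auto
  moreover have "x \<notin> R_set X u" by (simp add: R_set_def recurrent_eq)
  ultimately show ?thesis by (simp add: weak_orbit_def weak_orbit2_eq)
qed

text \<open>Over a closed orbit a point is either periodic in the product or has the orbit times the
  circle as its limit set; it is recurrent in both cases. All other points have their limit sets
  over singular points.\<close>

lemma recurrent_rotated:
  assumes "c \<noteq> 0"
  shows "recurrent Z (rotated_flow c u) = Cl \<times> sphere 0 1"
proof -
  interpret Z: compact_flow Z "rotated_flow c u" by (rule rotated_compact)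
  have "(x, \<zeta>) \<in> recurrent Z (rotated_flow c u) \<longleftrightarrow> x \<in> Cl"
    if x: "x \<in> topspace X" and \<zeta>: "cmod \<zeta> = 1" for x \<zeta>
  proof (cases "x \<in> Cl")
    case True
    have "(x, \<zeta>) \<in> omega_lim Z (rotated_flow c u) (x, \<zeta>)"
    proof (cases "(x, \<zeta>) \<in> Per Z (rotated_flow c u)")
      case True
      then show ?thesis
        using Z.orbit_subset_omega_lim_closed_orbit Z.orbit_self x \<zeta> by fastforce
    next
      case False
      then show ?thesis
        using omega_lim_rotated_irrational[OF True assms \<zeta>] orbit_self[OF x] \<zeta> by auto
    qed
    then show ?thesis using True x \<zeta> by (simp add: recurrent_def)
  next
    case False
    then obtain p q where "p \<in> Sing X u" "q \<in> Sing X u" "omega_lim X u x = {p}" "alpha_lim X u x = {q}"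
      using limits_singular[of x] x by blast
    then show ?thesis
      using omega_lim_rotated_singular[OF x _ assms \<zeta>] alpha_lim_rotated_singular[OF x _ assms \<zeta>] False
      by (auto simp: recurrent_def)
  qed
  note iff = this
  have sub: "recurrent Z (rotated_flow c u) \<subseteq> topspace Z"
    unfolding recurrent_def by blast
  show ?thesis
  proof (rule set_eqI)
    fix p :: "'a \<times> complex"
    obtain x \<zeta> where p: "p = (x, \<zeta>)" by fastforce
    show "p \<in> recurrent Z (rotated_flow c u) \<longleftrightarrow> p \<in> Cl \<times> sphere 0 1"
    proof (cases "x \<in> topspace X \<and> cmod \<zeta> = 1")
      case True
      then show ?thesis using iff[of x \<zeta>] p by (simp del: Un_iff)
    next
      case False
      then show ?thesis using p sub Cl_subset by auto
    qed
  qed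
qed

lemma limits_rotated_not_closed:
  assumes x: "x \<in> topspace X - Cl" and c: "c \<noteq> 0" and \<zeta>: "cmod \<zeta> = 1"
  shows "omega_lim' Z (rotated_flow c u) (x, \<zeta>) = omega_lim X u x \<times> sphere 0 1"
    "alpha_lim' Z (rotated_flow c u) (x, \<zeta>) = alpha_lim X u x \<times> sphere 0 1"
proof -
  have "orbit_of (rotated_flow c u) (x, \<zeta>) \<inter> Cl \<times> sphere 0 1 = {}"
    using orbit_rotated_subset[OF \<zeta>] orbit_not_closed[OF x] by blast
  then show "omega_lim' Z (rotated_flow c u) (x, \<zeta>) = omega_lim X u x \<times> sphere 0 1"
    "alpha_lim' Z (rotated_flow c u) (x, \<zeta>) = alpha_lim X u x \<times> sphere 0 1"
    using limits_singular[OF x] omega_lim_rotated_singular[OF _ _ c \<zeta>, of x]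
      alpha_lim_rotated_singular[OF _ _ c \<zeta>, of x] x
    by (auto simp: omega_lim'_def alpha_lim'_def)
qed

lemma connected_circle: "connectedin circle (sphere 0 1)"
  by (simp add: connectedin_subtopology connectedin_iff_connected connected_sphere)

text \<open>The limit condition is void on periodic points, so the class is a component of
  \<open>Per\<close> and not one periodic orbit: all phases over the orbit of \<open>x\<close> are
  connected. Projection to \<open>X\<close> and \<open>connected_subset_orbit\<close> keep different
  closed orbits apart.\<close>

lemma weak_orbit_rotated_periodic:
  assumes c: "c \<noteq> 0" and p: "(x, \<zeta>) \<in> Per Z (rotated_flow c u)"
  shows "weak_orbit Z (rotated_flow c u) (x, \<zeta>) = orbit_of u x \<times> sphere 0 1"
proof -
  interpret Z: compact_flow Z "rotated_flow c u" by (rule rotated_compact)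
  have x: "x \<in> topspace X" "x \<in> Cl" and \<zeta>: "cmod \<zeta> = 1"
    using p Per_rotated_subset[OF c] Cl_subset by auto
  define B where "B = Per Z (rotated_flow c u)"
  have B: "stratum Z (rotated_flow c u) (x, \<zeta>) = B"
    using p by (simp add: stratum_def B_def Sing_rotated[OF c])
  have "omega_lim' Z (rotated_flow c u) y = {}" "alpha_lim' Z (rotated_flow c u) y = {}"
    if "y \<in> B" for y
    using Z.omega_lim_closed_orbit[OF Z.Hausdorff, of y] Z.alpha_lim_closed_orbit[OF Z.Hausdorff, of y] that
    by (simp_all add: omega_lim'_def alpha_lim'_def B_def)
  moreover have "B \<subseteq> topspace Z" by (auto simp: B_def Per_def)
  ultimately have "{y \<in> topspace Z. alpha_lim' Z (rotated_flow c u) y = alpha_lim' Z (rotated_flow c u) (x, \<zeta>) \<and>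
      omega_lim' Z (rotated_flow c u) y = omega_lim' Z (rotated_flow c u) (x, \<zeta>)} \<inter> B = B"
    using p unfolding B_def[symmetric] by blast
  then have "weak_orbit Z (rotated_flow c u) (x, \<zeta>) = connected_component_of_set (subtopology Z B) (x, \<zeta>)"
    using p by (simp add: weak_orbit_def weak_orbit2_eq R_set_def B)
  also have "\<dots> = orbit_of u x \<times> sphere 0 1"
  proof (rule connected_component_of_unique)
    show "(x, \<zeta>) \<in> orbit_of u x \<times> sphere 0 1" using orbit_self x \<zeta> by simp
    have "connectedin Z (orbit_of u x \<times> sphere 0 1)"
      using connectedin_orbit[OF x(1)] connected_circle by (simp add: connectedin_Times)
    then show "connectedin (subtopology Z B) (orbit_of u x \<times> sphere 0 1)"
      using Per_rotated_orbit[OF c p] by (simp add: connectedin_subtopology B_def)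
    fix S assume "(x, \<zeta>) \<in> S \<and> connectedin (subtopology Z B) S"
    then have S: "(x, \<zeta>) \<in> S" "connectedin Z S" "S \<subseteq> B" by (auto simp: connectedin_subtopology)
    have "connectedin X (fst ` S)"
      by (rule connectedin_continuous_map_image[OF continuous_map_fst S(2)])
    moreover have SCl: "S \<subseteq> Cl \<times> sphere 0 1"
      using S(3) Per_rotated_subset[OF c] unfolding B_def by blast
    then have "fst ` S \<subseteq> Cl" by auto
    moreover have "x \<in> fst ` S" using S(1) by force
    ultimately have "fst ` S \<subseteq> orbit_of u x" by (rule connected_subset_orbit)
    then show "S \<subseteq> orbit_of u x \<times> sphere 0 1" using SCl by fastforce
  qed
  finally show ?thesis .
qed

text \<open>This is the clause of \<open>weak_orbit\<close> without components. At every point of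
  \<open>?C\<close> the orbit closure and both limit sets equal \<open>?C\<close>; conversely a
  point lies in its own orbit closure, so equality of closures puts it in \<open>?C\<close>.\<close>

lemma weak_orbit_rotated_irrational:
  assumes x: "x \<in> Cl" and c: "c \<noteq> 0" and \<zeta>: "cmod \<zeta> = 1"
    and notPer: "(x, \<zeta>) \<notin> Per Z (rotated_flow c u)"
  shows "weak_orbit Z (rotated_flow c u) (x, \<zeta>) = orbit_of u x \<times> sphere 0 1" (is "?L = ?C")
proof -
  interpret Z: compact_flow Z "rotated_flow c u" by (rule rotated_compact)
  have xX: "x \<in> topspace X" using x Cl_subset by blast
  have xC: "(x, \<zeta>) \<in> ?C" using orbit_self[OF xX] \<zeta> by simp
  have closed: "closedin Z ?C"
    using closedin_closed_orbit[of "orbit_of u x"] x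
    by (auto simp: closedin_prod_Times_iff closed_orbits_def)
  have all: "omega_lim Z (rotated_flow c u) (y, \<xi>) = ?C \<and> alpha_lim Z (rotated_flow c u) (y, \<xi>) = ?C \<and>
      Z closure_of orbit_of (rotated_flow c u) (y, \<xi>) = ?C"
    if y: "(y, \<xi>) \<in> ?C" for y \<xi>
  proof -
    have yX: "y \<in> topspace X" "cmod \<xi> = 1" using y orbit_subset_topspace[OF xX] by auto
    have orb: "orbit_of u y = orbit_of u x" using y orbit_eq[OF xX] by simp
    \<comment> \<open>One periodic point over the orbit would make all of \<open>?C\<close>
      periodic, including \<open>(x, \<zeta>)\<close>.\<close>
    have "(y, \<xi>) \<notin> Per Z (rotated_flow c u)"
    proof
      assume "(y, \<xi>) \<in> Per Z (rotated_flow c u)"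
      from Per_rotated_orbit[OF c this] have "?C \<subseteq> Per Z (rotated_flow c u)" using orb by simp
      then show False using notPer xC by blast
    qed
    moreover have "y \<in> Cl" using closed_orbit_points[OF x] y by blast
    ultimately have lim: "omega_lim Z (rotated_flow c u) (y, \<xi>) = ?C"
      "alpha_lim Z (rotated_flow c u) (y, \<xi>) = ?C"
      using omega_lim_rotated_irrational alpha_lim_rotated_irrational c yX orb by metis+
    moreover have "Z closure_of orbit_of (rotated_flow c u) (y, \<xi>) \<subseteq> ?C"
      using orbit_rotated_subset[OF yX(2)] closed unfolding orb[symmetric] by (rule closure_of_minimal)
    ultimately show ?thesis using Z.omega_lim_subset_closure_orbit by blast
  qed
  have "(x, \<zeta>) \<in> R_set Z (rotated_flow c u)"
    using notPer x \<zeta> by (simp add: R_set_def recurrent_rotated[OF c] Sing_rotated[OF c])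
  then have L: "?L = {y \<in> topspace Z. Z closure_of orbit_of (rotated_flow c u) y = ?C \<and>
      alpha_lim Z (rotated_flow c u) y = ?C \<and> omega_lim Z (rotated_flow c u) y = ?C}"
    using all[OF xC] by (simp add: weak_orbit_def)
  have "?C \<subseteq> topspace Z" using closed closedin_subset by blast
  then have "?C \<subseteq> ?L" unfolding L using all by auto
  moreover have "?L \<subseteq> ?C"
  proof
    fix y assume "y \<in> ?L"
    then have y: "y \<in> topspace Z" "Z closure_of orbit_of (rotated_flow c u) y = ?C" by (auto simp: L)
    have "y \<in> orbit_of (rotated_flow c u) y" using Z.orbit_self y(1) .
    then show "y \<in> ?C"
      using closure_of_subset[OF Z.orbit_subset_topspace[OF y(1)]] y(2) by blast
  qed
  ultimately show ?thesis by blast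
qed

text \<open>Stratum and limit sets are products with the circle, and components of a product are
  products of components; the circle is connected.\<close>

lemma weak_orbit_rotated_not_closed:
  assumes x: "x \<in> topspace X - Cl" and c: "c \<noteq> 0" and \<zeta>: "cmod \<zeta> = 1"
  shows "weak_orbit Z (rotated_flow c u) (x, \<zeta>) = weak_orbit X u x \<times> sphere 0 1"
proof -
  let ?w = "rotated_flow c u"
  define G where "G = {y \<in> topspace X - Cl. alpha_lim X u y = alpha_lim X u x \<and>
      omega_lim X u y = omega_lim X u x}"
  have notPer: "(x, \<zeta>) \<notin> Per Z ?w" using x Per_rotated_subset[OF c] by auto
  have P: "P_set Z ?w = (topspace X - Cl) \<times> sphere 0 1"
    by (auto simp: P_set_def recurrent_rotated[OF c])
  then have "stratum Z ?w (x, \<zeta>) = (topspace X - Cl) \<times> sphere 0 1"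
    using x \<zeta> notPer by (auto simp: stratum_def Sing_rotated[OF c])
  then have "{y \<in> topspace Z. alpha_lim' Z ?w y = alpha_lim' Z ?w (x, \<zeta>) \<and>
      omega_lim' Z ?w y = omega_lim' Z ?w (x, \<zeta>)} \<inter> stratum Z ?w (x, \<zeta>) = G \<times> sphere 0 1"
    \<comment> \<open>\<open>times_eq_iff\<close> cancels the circle from equal limit sets, as the
      circle is nonempty.\<close>
    using x \<zeta> by (auto simp: G_def limits_rotated_not_closed c times_eq_iff)
  moreover have "(x, \<zeta>) \<notin> R_set Z ?w" using x by (simp add: R_set_def recurrent_rotated[OF c])
  ultimately have "weak_orbit Z ?w (x, \<zeta>) =
      connected_component_of_set (subtopology Z (G \<times> sphere 0 1)) (x, \<zeta>)"
    by (simp add: weak_orbit_def weak_orbit2_eq)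
  also have "\<dots> = connected_component_of_set (subtopology X G) x \<times>
      connected_component_of_set circle \<zeta>"
    by (simp add: subtopology_Times subtopology_subtopology connected_component_of_pair)
  also have "connected_component_of_set circle \<zeta> = sphere 0 1"
    using connected_circle \<zeta> connected_component_of_subset_topspace[of circle \<zeta>]
    by (intro connected_component_of_unique) (auto dest!: connectedin_subset_topspace)
  also have "connected_component_of_set (subtopology X G) x = weak_orbit X u x"
    using weak_orbit_not_closed[OF x] by (simp add: G_def)
  finally show ?thesis .
qed

lemma weak_orbit_rotated:
  assumes "x \<in> topspace X" "c \<noteq> 0" "cmod \<zeta> = 1"
  shows "weak_orbit Z (rotated_flow c u) (x, \<zeta>) = weak_orbit X u x \<times> sphere 0 1"
proof (cases "x \<in> Cl")
  case True
  then show ?thesis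
    using weak_orbit_rotated_periodic weak_orbit_rotated_irrational assms weak_orbit_closed by metis
next
  case False
  then show ?thesis using weak_orbit_rotated_not_closed assms by blast
qed

end

section \<open>The mapping torus of the time-one map\<close>

context topological_flow
begin

lemma flow_inverse: "x \<in> topspace X \<Longrightarrow> u (- t) (u t x) = x"
  using flow_add[of x "- t" t] by simp

text \<open>On the space, \<open>inv_into\<close> of \<open>u 1\<close> is \<open>u (- 1)\<close>,
  so negative iterates are values of the flow as well.\<close>

lemma int_iter_time_one:
  assumes x: "x \<in> topspace X"
  shows "int_iter X (u 1) n x = u (of_int n) x"
proof -
  have inj: "inj_on (u 1) (topspace X)"
    by (rule inj_on_inverseI[of _ "u (- 1)"]) (rule flow_inverse)
  have inv: "inv_into (topspace X) (u 1) y = u (- 1) y" if "y \<in> topspace X" for y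
  proof -
    have "u 1 (u (- 1) y) = y" using flow_inverse[OF that, of "- 1"] by simp
    then show ?thesis using inv_into_f_f[OF inj, of "u (- 1) y"] that by simp
  qed
  have "(u 1 ^^ k) x = u (real k) x" for k
    by (induction k) (simp_all add: x flow_add[OF x, symmetric])
  moreover have "(inv_into (topspace X) (u 1) ^^ k) x = u (- real k) x" for k
  proof (induction k)
    case (Suc k)
    then show ?case using flow_add[OF x, of "- 1" "- real k"] x by (simp add: inv)
  qed (simp add: x)
  ultimately show ?thesis by (simp add: int_iter_def)
qed

lemma torus_class_time_one:
  assumes "x \<in> topspace X"
  shows "torus_class X (u 1) (x, t) = range (\<lambda>n. (u (of_int n) x, t - of_int n))"
  using assms by (auto simp: torus_class_def int_iter_time_one)

lemma torus_class_shift: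
  assumes x: "x \<in> topspace X"
  shows "torus_class X (u 1) (u (of_int n) x, t - of_int n) = torus_class X (u 1) (x, t)"
proof -
  have "u (of_int m) (u (of_int n) x) = u (of_int (m + n)) x" for m
    using flow_add[OF x, of "of_int m" "of_int n"] by simp
  moreover have "t - of_int n - of_int m = t - of_int (m + n)" for m by simp
  ultimately have "torus_class X (u 1) (u (of_int n) x, t - of_int n)
      = range (\<lambda>m. (u (of_int (m + n)) x, t - of_int (m + n)))"
    using torus_class_time_one[of "u (of_int n) x" "t - of_int n"] x by (simp only: flow_in_topspace)
  also have "\<dots> = (\<lambda>m. (u (of_int m) x, t - of_int m)) ` range (\<lambda>m. m + n)"
    by (simp only: image_image)
  finally have "torus_class X (u 1) (u (of_int n) x, t - of_int n)
      = (\<lambda>m. (u (of_int m) x, t - of_int m)) ` range (\<lambda>m. m + n)" .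
  moreover have "range (\<lambda>m. m + n) = UNIV" by (rule surjI[of _ "\<lambda>m. m - n"]) simp
  ultimately show ?thesis using x by (simp add: torus_class_time_one)
qed

text \<open>Trivializes the mapping torus of the time-one map as a product with the circle.\<close>

definition untwist :: "('a \<times> real) set \<Rightarrow> 'a \<times> complex" where
  "untwist C = the_elem ((\<lambda>(x, t). (u t x, cis (2 * pi * t))) ` C)"

text \<open>All representatives \<open>(u n x, t - n)\<close> have the same image, since the two
  shifts by \<open>n\<close> cancel and \<open>cis\<close> has period \<open>2 * pi\<close>. Thus
  \<open>the_elem\<close> is applied to a singleton.\<close>

lemma untwist_torus_class:
  assumes x: "x \<in> topspace X"
  shows "untwist (torus_class X (u 1) (x, t)) = (u t x, cis (2 * pi * t))"
proof -
  have "u (t - of_int n) (u (of_int n) x) = u t x" for n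
    using flow_add[OF x, of "t - of_int n" "of_int n"] by simp
  moreover have "cis (2 * pi * (t - of_int n)) = cis (2 * pi * t)" for n
    using cis_shift[of "2 * pi * t" n] by (simp add: algebra_simps)
  ultimately have "(\<lambda>(x, t). (u t x, cis (2 * pi * t))) ` torus_class X (u 1) (x, t)
      = {(u t x, cis (2 * pi * t))}"
    using x by (auto simp: torus_class_time_one image_image)
  then show ?thesis by (simp add: untwist_def)
qed

lemma topspace_mapping_torus:
  "topspace (mapping_torus X f) = torus_class X f ` (topspace X \<times> UNIV)"
  by (simp add: mapping_torus_def)

lemma torus_class_in_mapping_torus:
  "x \<in> topspace X \<Longrightarrow> torus_class X f (x, t) \<in> topspace (mapping_torus X f)"
  by (auto simp: topspace_mapping_torus)

lemma continuous_map_torus_class: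
  "continuous_map (prod_topology X euclideanreal) (mapping_torus X f) (torus_class X f)"
  unfolding mapping_torus_def
  by (rule quotient_imp_continuous_map[OF quotient_map_quotient_space])

lemma continuous_map_untwist:
  "continuous_map (mapping_torus X (u 1)) (prod_topology X circle) untwist"
  unfolding mapping_torus_def
proof (rule continuous_compose_quotient_map[OF quotient_map_quotient_space])
  have "continuous_map (prod_topology X euclideanreal) (prod_topology euclideanreal X)
      (\<lambda>p. (snd p, fst p))"
    by (intro continuous_map_pairedI continuous_map_fst continuous_map_snd)
  from continuous_map_compose[OF this continuous_map_flow]
  have 1: "continuous_map (prod_topology X euclideanreal) X (\<lambda>p. u (snd p) (fst p))"
    by (simp add: o_def case_prod_unfold)
  have "continuous_map euclideanreal circle (\<lambda>t. cis (2 * pi * t))"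
    by (auto simp: continuous_map_in_subtopology intro!: continuous_intros)
  from continuous_map_compose[OF continuous_map_snd this]
  have 2: "continuous_map (prod_topology X euclideanreal) circle (\<lambda>p. cis (2 * pi * snd p))"
    by (simp add: o_def)
  have "continuous_map (prod_topology X euclideanreal) (prod_topology X circle)
      (\<lambda>p. (u (snd p) (fst p), cis (2 * pi * snd p)))"
    by (rule continuous_map_pairedI[OF 1 2])
  then show "continuous_map (prod_topology X euclideanreal) (prod_topology X circle)
      (untwist \<circ> torus_class X (u 1))"
    by (rule continuous_map_eq) (auto simp: untwist_torus_class)
qed

text \<open>Equal phases make \<open>n = t - s\<close> an integer; the first coordinates then give
  \<open>y = u n x\<close>, which is the gluing relation.\<close>

lemma inj_on_untwist: "inj_on untwist (topspace (mapping_torus X (u 1)))"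
proof -
  have "torus_class X (u 1) (x, t) = torus_class X (u 1) (y, s)"
    if x: "x \<in> topspace X" and y: "y \<in> topspace X"
      and eq: "u t x = u s y" "cis (2 * pi * t) = cis (2 * pi * s)" for x t y s
  proof -
    have "cis (2 * pi * t - 2 * pi * s) = 1"
      using eq(2) by (simp flip: cis_divide)
    then have "cos (2 * pi * (t - s)) = 1"
      by (simp add: complex_eq_iff right_diff_distrib)
    then obtain n :: int where "2 * pi * (t - s) = of_int n * 2 * pi"
      by (metis cos_one_2pi_int)
    then have "2 * pi * (t - s) = 2 * pi * of_int n" by (simp only: mult.commute mult.left_commute)
    then have n: "s = t - of_int n" by (simp only: mult_cancel_left) simp
    have "y = u (- s) (u t x)" using flow_inverse[OF y, of s] eq(1) by simp
    also have "\<dots> = u (of_int n) x" using flow_add[OF x, of "- s" t] n by simp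
    finally show ?thesis using torus_class_shift[OF x, of n t] n by simp
  qed
  note same_class = this
  show ?thesis
  proof (rule inj_onI)
    fix C D
    assume "C \<in> topspace (mapping_torus X (u 1))" "D \<in> topspace (mapping_torus X (u 1))"
      and eq: "untwist C = untwist D"
    then obtain x t y s where "x \<in> topspace X" "C = torus_class X (u 1) (x, t)"
      "y \<in> topspace X" "D = torus_class X (u 1) (y, s)"
      by (auto simp: topspace_mapping_torus)
    then show "C = D" using same_class[of x y t s] eq by (simp add: untwist_torus_class)
  qed
qed

lemma untwist_surj:
  "untwist ` topspace (mapping_torus X (u 1)) = topspace (prod_topology X circle)"
proof
  show "untwist ` topspace (mapping_torus X (u 1)) \<subseteq> topspace (prod_topology X circle)"
    by (rule continuous_map_image_subset_topspace[OF continuous_map_untwist])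
  show "topspace (prod_topology X circle) \<subseteq> untwist ` topspace (mapping_torus X (u 1))"
  proof
    fix p assume "p \<in> topspace (prod_topology X circle)"
    then obtain x z where p: "p = (x, z)" "x \<in> topspace X" "cmod z = 1" by auto
    obtain b where b: "cis b * 1 = z" using circle_transitive[of 1 z] p by auto
    let ?t = "b / (2 * pi)"
    \<comment> \<open>Height \<open>?t\<close> produces the phase \<open>z\<close>; flowing
      \<open>x\<close> back by \<open>?t\<close> compensates the twist.\<close>
    have "u ?t (u (- ?t) x) = x" using flow_inverse[OF p(2), of "- ?t"] by simp
    then have "p = untwist (torus_class X (u 1) (u (- ?t) x, ?t))"
      using p b by (simp add: untwist_torus_class)
    then show "p \<in> untwist ` topspace (mapping_torus X (u 1))"
      using torus_class_in_mapping_torus p(2) by simp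
  qed
qed

text \<open>Each class has a representative of height in \<open>{0..1}\<close>. Compactness makes
  the continuous bijection \<open>untwist\<close> onto a Hausdorff space a homeomorphism, which
  avoids studying its inverse.\<close>

lemma compact_space_mapping_torus:
  assumes "compact_space X"
  shows "compact_space (mapping_torus X (u 1))"
proof -
  have "torus_class X (u 1) (x, t) \<in> torus_class X (u 1) ` (topspace X \<times> {0..1})"
    if "x \<in> topspace X" for x t
  proof -
    have "t - of_int \<lfloor>t\<rfloor> \<in> {0..1}" by (simp; linarith)
    then show ?thesis using torus_class_shift[OF that, of "\<lfloor>t\<rfloor>" t] that
      by (metis SigmaI flow_in_topspace image_eqI)
  qed
  then have "topspace (mapping_torus X (u 1)) = torus_class X (u 1) ` (topspace X \<times> {0..1})"
    by (auto simp: topspace_mapping_torus)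
  moreover have "compactin (prod_topology X euclideanreal) (topspace X \<times> {0..1})"
    using assms by (simp add: compactin_Times compact_space_def)
  ultimately show ?thesis
    using image_compactin[OF _ continuous_map_torus_class] by (metis compact_space_def)
qed

end

context compact_flow
begin

text \<open>Raising the height by \<open>t\<close> turns the phase by \<open>2 * pi * t\<close>,
  hence the speed, and moves \<open>u s x\<close> to \<open>u (t + s) x\<close>.\<close>

lemma suspension_conjugacy:
  "flow_conjugacy (mapping_torus X (u 1)) suspension Z (rotated_flow (2 * pi) u) untwist"
proof
  interpret Z: compact_flow Z "rotated_flow (2 * pi) u" by (rule rotated_compact)
  show "homeomorphic_map (mapping_torus X (u 1)) Z untwist"
    using continuous_imp_homeomorphic_map compact_space_mapping_torus[OF compact] Z.Hausdorff
      continuous_map_untwist untwist_surj inj_on_untwist by blast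
  fix C t assume "C \<in> topspace (mapping_torus X (u 1))"
  then obtain x s where x: "x \<in> topspace X" and C: "C = torus_class X (u 1) (x, s)"
    by (auto simp: topspace_mapping_torus)
  show "suspension t C \<in> topspace (mapping_torus X (u 1))"
    using x by (simp add: C suspension_torus_class torus_class_in_mapping_torus)
  show "untwist (suspension t C) = rotated_flow (2 * pi) u t (untwist C)"
    using x by (simp add: C suspension_torus_class untwist_torus_class rotated_flow_def flow_add
        distrib_left cis_mult)
qed

end

context gradient_like_flow
begin

lemma weak_orbit_subset: "x \<in> topspace X \<Longrightarrow> weak_orbit X u x \<subseteq> topspace X"
proof -
  have "weak_orbit2 X u x \<subseteq> topspace X"
    unfolding weak_orbit2_eq using connected_component_of_subset_topspace by fastforce
  then show ?thesis by (auto simp: weak_orbit_def)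
qed

text \<open>\<open>untwist\<close> sends the class of \<open>(x, 0)\<close> to
  \<open>(x, 1)\<close>. Since classes in the product contain full circles, comparing points in the
  fibre over \<open>1\<close> loses nothing.\<close>

lemma weak_orbit_time_one:
  assumes x: "x \<in> topspace X"
  shows "weak_orbit_homeo X (u 1) x = weak_orbit X u x"
proof -
  interpret c: flow_conjugacy "mapping_torus X (u 1)" suspension Z "rotated_flow (2 * pi) u" untwist
    by (rule suspension_conjugacy)
  have "torus_class X (u 1) (y, 0) \<in> weak_orbit (mapping_torus X (u 1)) suspension (torus_class X (u 1) (x, 0))
      \<longleftrightarrow> y \<in> weak_orbit X u x" if y: "y \<in> topspace X" for y
    using c.weak_orbit_iff[OF torus_class_in_mapping_torus[OF x, of "u 1" 0]
        torus_class_in_mapping_torus[OF y, of "u 1" 0]]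
      weak_orbit_rotated[OF x, of "2 * pi" 1] x y
    by (simp add: untwist_torus_class)
  then show ?thesis
    using weak_orbit_subset[OF x] by (auto simp: weak_orbit_homeo_def)
qed

end

section \<open>Morse flows and the final comparison\<close>

lemma closed_orbit_limits_topologically_equivalent:
  assumes v: "flow_on X v" and w: "flow_on X w" and eqv: "topologically_equivalent X v w"
    and fin: "finite (closed_orbits X w)"
    and lim: "\<And>y. y \<in> topspace X \<Longrightarrow> omega_lim X w y \<in> closed_orbits X w"
      "\<And>y. y \<in> topspace X \<Longrightarrow> alpha_lim X w y \<in> closed_orbits X w"
  shows "finite (closed_orbits X v)"
    and "x \<in> topspace X \<Longrightarrow> omega_lim X v x \<in> closed_orbits X v"
    and "x \<in> topspace X \<Longrightarrow> alpha_lim X v x \<in> closed_orbits X v"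
proof -
  interpret v: topological_flow X v by (rule topological_flow.intro) fact
  obtain h where h: "homeomorphic_map X X h"
    "\<And>x. x \<in> topspace X \<Longrightarrow> \<exists>\<theta>. strict_mono \<theta> \<and> surj \<theta> \<and> (\<forall>t. h (v t x) = w (\<theta> t) (h x))"
    using eqv unfolding topologically_equivalent_def by blast
  interpret h: orbit_equivalence X v X w h
    by unfold_locales (use h in auto)
  have closed: "closed_orbits X w = (`) h ` closed_orbits X v"
    by (rule h.closed_orbits_image[OF v w])
  have subset: "C \<subseteq> topspace X" if C: "C \<in> closed_orbits X v" for C
  proof -
    obtain c where "c \<in> Sing X v \<union> Per X v" "C = orbit_of v c"
      using C by (auto simp: closed_orbits_def)
    then show ?thesis using v.orbit_subset_topspace v.Cl_iff by blast
  qed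
  \<comment> \<open>Taking images is injective on subsets of the space, so finiteness and membership
    pull back along \<open>closed\<close>.\<close>
  then have "inj_on ((`) h) (closed_orbits X v)"
    using inj_on_image_eq_iff[OF h.inj] unfolding inj_on_def by (metis (no_types))
  then show "finite (closed_orbits X v)"
    using fin closed finite_imageD by metis
  have preimage: "A \<in> closed_orbits X v" if "h ` A \<in> closed_orbits X w" "A \<subseteq> topspace X" for A
  proof -
    from that(1) obtain C where C: "C \<in> closed_orbits X v" "h ` A = h ` C"
      unfolding closed by (rule imageE)
    then have "A = C" using inj_on_image_eq_iff[OF h.inj that(2) subset] by blast
    then show ?thesis using C by simp
  qed
  assume x: "x \<in> topspace X"
  show "omega_lim X v x \<in> closed_orbits X v"
    using preimage lim(1)[OF h.in_topspace[OF x]] omega_lim_subset_topspace[of X v x]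
    by (simp add: h.omega_lim_image[OF x])
  show "alpha_lim X v x \<in> closed_orbits X v"
    using preimage lim(2)[OF h.in_topspace[OF x]] alpha_lim_subset_topspace[of X v x]
    by (simp add: h.alpha_lim_image[OF x])
qed

text \<open>The finiteness condition on the nonwandering set is given for the smooth representative
  \<open>w\<close>; its consequences for limit sets pass to \<open>v\<close> by the equivalence.
  Absence of limit cycles is given for \<open>v\<close> itself.\<close>

lemma morse_flow_gradient_like:
  assumes M: "smooth_manifold M" "compact_space (man_top M)" and "morse_flow M v"
  shows "gradient_like_flow (man_top M) v"
proof -
  let ?X = "man_top M"
  have v: "flow_on ?X v" and cycle: "\<not> limit_cycle ?X v C" for C
    using assms by (auto simp: morse_flow_def morse_smale_flow_def)
  obtain \<xi> w where w: "flow_on ?X w" and eqv: "topologically_equivalent ?X v w"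
    and hyp: "finitely_many_hyperbolic M \<xi> w ?X (man_model M)"
    using assms unfolding morse_flow_def morse_smale_flow_def morse_smale_vfield_def flow_of_vfield_def
    by blast
  have "Hausdorff_space ?X" using M(1) by (simp add: smooth_manifold_def)
  then interpret w: compact_flow ?X w
    using w M(2) by unfold_locales
  obtain K where "finite K" "K \<subseteq> closed_orbits ?X w" "nonwandering ?X w = \<Union>K"
  proof -
    from hyp obtain K where K: "finite K" "K \<subseteq> hyperbolic_closed_orbits M \<xi> w ?X (man_model M)"
      "nonwandering ?X w = \<Union>K"
      unfolding finitely_many_hyperbolic_def by (elim exE conjE)
    moreover have "hyperbolic_closed_orbits M \<xi> w ?X (man_model M) \<subseteq> closed_orbits ?X w"
      unfolding hyperbolic_closed_orbits_def by (rule Collect_subset)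
    ultimately show ?thesis using that[of K] by (meson subset_trans)
  qed
  note limits_w = w.finite_nonwandering_limits[OF this]
  note limits_v = closed_orbit_limits_topologically_equivalent[OF v w eqv limits_w]
  show ?thesis
    by unfold_locales (use v M(2) \<open>Hausdorff_space ?X\<close> cycle limits_v in auto)
qed

theorem corollary11p4:
  fixes M :: "('a, 'e::euclidean_space) manifold"
    and v :: "real \<Rightarrow> 'a \<Rightarrow> 'a"
  assumes "smooth_manifold M"
    and "compact_space (man_top M)"
    and "morse_flow M v"
  shows "weak_orbit_space (man_top M) v homeomorphic_space
         weak_orbit_space_homeo (man_top M) (v 1)"
proof -
  interpret gradient_like_flow "man_top M" v
    by (rule morse_flow_gradient_like[OF assms])
  \<comment> \<open>Equal class maps give literally the same quotient topology, so the homeomorphism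
    is the identity.\<close>
  have "weak_orbit_space_homeo (man_top M) (v 1) = weak_orbit_space (man_top M) v"
    unfolding weak_orbit_space_homeo_def weak_orbit_space_def
    by (rule quotient_space_cong) (rule weak_orbit_time_one)
  then show ?thesis by (simp add: homeomorphic_space_refl)
qed

end
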